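(* Let $(G,\mu,\alpha,\beta)$ be a BiHom-algebra over a field $\mathbb K$ of characteristic $0$ with $\beta$ surjective, and let $(M,\rho,\kappa,\tau)$ and $(N,\rho',\kappa',\tau')$ be right BiHom-modules over $G$. Assume that $\sigma:M\to N$ is a morphism of right BiHom-modules. Then the restricted dual map $\sigma^{\circ}:=\sigma^{*}|_{N^{\circ}}:N^{\circ}\to M^{\circ}$, where $\sigma^{*}(f)=f\circ\sigma$, is (well defined and) a morphism of right BiHom-comodules over the Sweedler dual BiHom-coalgebra $(G^{\circ},\Delta,\beta^{\circ},\alpha^{\circ})$, from $(N^{\circ},\rho'^{\circ},\tau'^{\circ},\kappa'^{\circ})$ to $(M^{\circ},\rho^{\circ},\tau^{\circ},\kappa^{\circ})$.
   Context: All vector spaces and tensor products are over a field $\mathbb K$ of characteristic $0$; spaces may be infinite-dimensional. $V^{*}$ denotes the full linear dual. $U^{*}\otimes V^{*}$ is viewed as a subspace of $(U\otimes V)^{*}$ via $(f\otimes g)(x\otimes y)=f(x)g(y)$. A BiHom-algebra is a quadruple $(G,\mu,\alpha,\beta)$ with $G$ a vector space, $\mu:G\otimes G\to G$ linear, written $\mu(g\otimes h)=gh$, and $\alpha,\beta:G\to G$ linear with $\alpha\circ\beta=\beta\circ\alpha$, such that for all $g,h,k\in G$: $\alpha(g)(hk)=(gh)\beta(k)$, $\alpha(hk)=\alpha(h)\alpha(k)$, $\beta(hk)=\beta(h)\beta(k)$. No unit is assumed. An ideal of $G$ is a subspace $H\subseteq G$ with $\alpha(H)\subseteq H$, $\beta(H)\subseteq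 H$, and $ab\in H$, $ba\in H$ for all $a\in G$, $b\in H$. It is finite-codimensional if $\dim(G/H)<\infty$. A right BiHom-module over $G$ is a quadruple $(M,\rho,\kappa,\tau)$ with $M$ a vector space, $\rho:M\otimes G\to M$ linear, written $\rho(m\otimes g)=m\cdot g$, and commuting linear maps $\kappa,\tau:M\to M$ such that $\rho\circ(\rho\otimes\beta)=\rho\circ(\kappa\otimes\mu)$, $\rho\circ(\kappa\otimes\alpha)=\kappa\circ\rho$, $\rho\circ(\tau\otimes\beta)=\tau\circ\rho$. A morphism of right BiHom-modules $(M,\rho,\kappa,\tau)\to(N,\rho',\kappa',\tau')$ is a linear map $\sigma:M\to N$ with $\sigma\circ\rho=\rho'\circ(\sigma\otimes\mathrm{Id}_G)$, $\kappa'\circ\sigma=\sigma\circ\kappa$, $\tau'\circ\sigma=\sigma\circ\tau$. For an ideal $J\subseteq G$, $M\cdot J$ denotes the linear span of all $m\cdot j$ with $m\in M$, $j\in J$. Sweedler duals: $G^{\circ}=\{f\in G^{*}\mid f(J)=0 \text{ for some finite-codimensional ideal } J\subseteq G\}$ and $M^{\circ}=\{f\in M^{*}\mid f(M\cdot J)=0 \text{ for some finite-codimensional ideal } J\subseteq G\}$; similarly $N^{\circ}$. A BiHom-coalgebra is a quadruple $(C,\Delta,\psi,\phi)$ with $C$ a vector space, $\Delta:C\to C\otimes C$ linear, $\psi,\phi:C\to C$ commuting linear maps, such that $(\phi\otimes\Delta)\circ\Delta=(\Delta\otimes\psi)\circ\Delta$, $\Delta\circ\psi=(\psi\otimes\psi)\circ\Delta$,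 $\Delta\circ\phi=(\phi\otimes\phi)\circ\Delta$. The Sweedler dual BiHom-coalgebra of $G$ is $(G^{\circ},\Delta,\beta^{\circ},\alpha^{\circ})$ (so $\psi=\beta^{\circ}$, $\phi=\alpha^{\circ}$) with $\Delta(f)=f\circ\mu\in G^{\circ}\otimes G^{\circ}\subseteq(G\otimes G)^{*}$, $\alpha^{\circ}(f)=f\circ\alpha$, $\beta^{\circ}(f)=f\circ\beta$. A right BiHom-comodule over a BiHom-coalgebra $(C,\Delta,\psi,\phi)$ is a quadruple $(A,\gamma,\omega,\theta)$ with $A$ a vector space, $\gamma:A\to A\otimes C$ linear, and commuting linear maps $\omega,\theta:A\to A$ such that $(\gamma\otimes\psi)\circ\gamma=(\theta\otimes\Delta)\circ\gamma$, $(\omega\otimes\psi)\circ\gamma=\gamma\circ\omega$, $(\theta\otimes\phi)\circ\gamma=\gamma\circ\theta$. A morphism of right BiHom-comodules $(A,\gamma,\omega,\theta)\to(A',\gamma',\omega',\theta')$ over $C$ is a linear map $f:A\to A'$ with $\gamma'\circ f=(f\otimes\mathrm{Id}_C)\circ\gamma$, $\omega'\circ f=f\circ\omega$, $\theta'\circ f=f\circ\theta$. Since $\beta$ is surjective, it is a known fact that every right BiHom-module $(M,\rho,\kappa,\tau)$ over $G$ yields a right BiHom-comodule $(M^{\circ},\rho^{\circ},\tau^{\circ},\kappa^{\circ})$ over $(G^{\circ},\Delta,\beta^{\circ},\alpha^{\circ})$ (so $\omega=\tau^{\circ}$, $\theta=\kappa^{\circ}$), where $\rho^{\circ}(\xi)=\xi\circ\rho\in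 M^{\circ}\otimes G^{\circ}\subseteq(M\otimes G)^{*}$, $\kappa^{\circ}(\xi)=\xi\circ\kappa$, $\tau^{\circ}(\xi)=\xi\circ\tau$ for $\xi\in M^{\circ}$; these are the structures used on $M^{\circ}$ and $N^{\circ}$. *)

theory Defs
  imports Complex_Main "HOL-Library.Function_Algebras" "HOL-Library.FuncSet"
begin

section \<open>Vector spaces as subspaces of an ambient type\<close>

text \<open>
  Sweedler duals are proper subspaces of function types that depend on term parameters, so the
  spaces underlying coalgebras and comodules are given by a carrier set together with a scalar
  multiplication; the addition is that of the ambient type.
\<close>

record ('k, 'a) vs =
  vs_carrier :: "'a set"
  vs_scale :: "'k \<Rightarrow> 'a \<Rightarrow> 'a"

definition is_vs :: "('k::field, 'a::ab_group_add) vs \<Rightarrow> bool" where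
  "is_vs V \<longleftrightarrow> vector_space (vs_scale V) \<and> module.subspace (vs_scale V) (vs_carrier V)"

definition linear_on ::
  "('k::field, 'a::ab_group_add) vs \<Rightarrow> ('k, 'b::ab_group_add) vs \<Rightarrow> ('a \<Rightarrow> 'b) \<Rightarrow> bool" where
  "linear_on V W f \<longleftrightarrow>
     f \<in> vs_carrier V \<rightarrow> vs_carrier W \<and>
     (\<forall>x\<in>vs_carrier V. \<forall>y\<in>vs_carrier V. f (x + y) = f x + f y) \<and>
     (\<forall>c. \<forall>x\<in>vs_carrier V. f (vs_scale V c x) = vs_scale W c (f x))"

definition bilinear_on ::
  "('k::field, 'a::ab_group_add) vs \<Rightarrow> ('k, 'b::ab_group_add) vs \<Rightarrow> ('k, 'c::ab_group_add) vs
     \<Rightarrow> ('a \<Rightarrow> 'b \<Rightarrow> 'c) \<Rightarrow> bool" where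
  "bilinear_on V W U B \<longleftrightarrow>
     (\<forall>x\<in>vs_carrier V. linear_on W U (B x)) \<and>
     (\<forall>y\<in>vs_carrier W. linear_on V U (\<lambda>x. B x y))"

definition base_field :: "('k::field, 'k) vs" where
  "base_field = \<lparr>vs_carrier = UNIV, vs_scale = (*)\<rparr>"

definition fun_scale :: "'k::field \<Rightarrow> ('x \<Rightarrow> 'k) \<Rightarrow> 'x \<Rightarrow> 'k" where
  "fun_scale c f = (\<lambda>x. c * f x)"


section \<open>Tensor products\<close>

text \<open>
  Bilinear forms separate the points of a tensor product over a field. Hence \<open>V \<otimes> W\<close> is modelled
  inside the dual of the space of bilinear forms on \<open>V \<times> W\<close>: the elementary tensor of \<open>v\<close> and \<open>w\<close>
  is evaluation at \<open>(v, w)\<close>, and \<open>V \<otimes> W\<close> is the span of these. The usual universal property is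
  lemma \<open>tensor_universal\<close> below.
\<close>

type_synonym ('k, 'a, 'b) tensor = "('a \<Rightarrow> 'b \<Rightarrow> 'k) \<Rightarrow> 'k"

definition pure ::
  "('k::field, 'a::ab_group_add) vs \<Rightarrow> ('k, 'b::ab_group_add) vs \<Rightarrow> 'a \<Rightarrow> 'b \<Rightarrow> ('k, 'a, 'b) tensor" where
  "pure V W v w = (\<lambda>B. if bilinear_on V W base_field B then B v w else 0)"

definition tensor ::
  "('k::field, 'a::ab_group_add) vs \<Rightarrow> ('k, 'b::ab_group_add) vs \<Rightarrow> ('k, ('k, 'a, 'b) tensor) vs" where
  "tensor V W =
     \<lparr>vs_carrier = module.span fun_scale {pure V W v w |v w. v \<in> vs_carrier V \<and> w \<in> vs_carrier W},
      vs_scale = fun_scale\<rparr>"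

text \<open>
  The map \<open>f \<otimes> g\<close> into \<open>V' \<otimes> W'\<close>, and the canonical isomorphism
  \<open>(U \<otimes> V) \<otimes> W \<rightarrow> U \<otimes> (V \<otimes> W)\<close>; see lemmas \<open>tensor_map_pure\<close> and \<open>tensor_assoc_pure\<close>.
\<close>

definition tensor_map ::
  "('k::field, 'c::ab_group_add) vs \<Rightarrow> ('k, 'd::ab_group_add) vs \<Rightarrow> ('a \<Rightarrow> 'c) \<Rightarrow> ('b \<Rightarrow> 'd)
     \<Rightarrow> ('k, 'a, 'b) tensor \<Rightarrow> ('k, 'c, 'd) tensor" where
  "tensor_map V' W' f g t =
     (\<lambda>B. if bilinear_on V' W' base_field B then t (\<lambda>v w. B (f v) (g w)) else 0)"

definition tensor_assoc ::
  "('k::field, 'a::ab_group_add) vs \<Rightarrow> ('k, 'b::ab_group_add) vs \<Rightarrow> ('k, 'c::ab_group_add) vs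
     \<Rightarrow> ('k, ('k, 'a, 'b) tensor, 'c) tensor \<Rightarrow> ('k, 'a, ('k, 'b, 'c) tensor) tensor" where
  "tensor_assoc U V W t =
     (\<lambda>B. if bilinear_on U (tensor V W) base_field B
          then t (\<lambda>s w. s (\<lambda>u v. B u (pure V W v w))) else 0)"

lemma vector_space_fun_scale: "vector_space (fun_scale :: 'k::field \<Rightarrow> ('x \<Rightarrow> 'k) \<Rightarrow> 'x \<Rightarrow> 'k)"
  by unfold_locales (auto simp: fun_scale_def fun_eq_iff algebra_simps)

interpretation FS: vector_space "fun_scale :: 'k::field \<Rightarrow> ('x \<Rightarrow> 'k) \<Rightarrow> 'x \<Rightarrow> 'k"
  by (rule vector_space_fun_scale)

lemma is_vs_tensor: "is_vs (tensor V W)"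
  by (simp add: is_vs_def tensor_def vector_space_fun_scale)

lemma linear_on_add: "linear_on V W f \<Longrightarrow> x \<in> vs_carrier V \<Longrightarrow> y \<in> vs_carrier V \<Longrightarrow> f (x + y) = f x + f y"
  and linear_on_scale: "linear_on V W f \<Longrightarrow> x \<in> vs_carrier V \<Longrightarrow> f (vs_scale V c x) = vs_scale W c (f x)"
  and linear_on_in: "linear_on V W f \<Longrightarrow> x \<in> vs_carrier V \<Longrightarrow> f x \<in> vs_carrier W"
  by (auto simp: linear_on_def)

lemma is_vs_add: "is_vs V \<Longrightarrow> x \<in> vs_carrier V \<Longrightarrow> y \<in> vs_carrier V \<Longrightarrow> x + y \<in> vs_carrier V"
  and is_vs_scale: "is_vs V \<Longrightarrow> x \<in> vs_carrier V \<Longrightarrow> vs_scale V c x \<in> vs_carrier V"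
  by (auto simp: is_vs_def module.subspace_def module_iff_vector_space)

lemma linear_on_comp: "linear_on U V f \<Longrightarrow> linear_on V W g \<Longrightarrow> linear_on U W (\<lambda>x. g (f x))"
  by (auto simp: linear_on_def Pi_iff)

lemma bilinear_on_comp:
  assumes "bilinear_on V' W' U B" "linear_on V V' f" "linear_on W W' g"
  shows "bilinear_on V W U (\<lambda>v w. B (f v) (g w))"
  unfolding bilinear_on_def
proof (intro conjI ballI)
  fix x assume "x \<in> vs_carrier V"
  with assms show "linear_on W U (\<lambda>w. B (f x) (g w))"
    by (intro linear_on_comp[OF assms(3)]) (auto simp: bilinear_on_def linear_on_def Pi_iff)
next
  fix y assume "y \<in> vs_carrier W"
  then have "g y \<in> vs_carrier W'" using assms by (auto simp: linear_on_def)
  then have "linear_on V' U (\<lambda>x. B x (g y))" using assms by (auto simp: bilinear_on_def)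
  from linear_on_comp[OF assms(2) this] show "linear_on V U (\<lambda>v. B (f v) (g y))" .
qed

lemma tensor_map_pure:
  assumes "linear_on V V' f" "linear_on W W' g"
  shows "tensor_map V' W' f g (pure V W v w) = pure V' W' (f v) (g w)"
  using bilinear_on_comp[OF _ assms] by (auto simp: tensor_map_def pure_def fun_eq_iff)

lemma pure_in_tensor:
  "v \<in> vs_carrier V \<Longrightarrow> w \<in> vs_carrier W \<Longrightarrow> pure V W v w \<in> vs_carrier (tensor V W)"
  by (auto simp: tensor_def intro!: FS.span_base)

lemma tensor_induct [consumes 1, case_names zero pure add]:
  assumes "t \<in> vs_carrier (tensor V W)"
    and "P 0"
    and "\<And>c v w t. v \<in> vs_carrier V \<Longrightarrow> w \<in> vs_carrier W \<Longrightarrow> t \<in> vs_carrier (tensor V W) \<Longrightarrow> P t \<Longrightarrow>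
           P (fun_scale c (pure V W v w) + t)"
  shows "P t"
proof -
  have "t \<in> FS.span {pure V W v w |v w. v \<in> vs_carrier V \<and> w \<in> vs_carrier W}"
    using assms(1) by (simp add: tensor_def)
  then have "t \<in> vs_carrier (tensor V W) \<and> P t"
  proof (induction rule: FS.span_induct_alt)
    case base
    from assms(2) FS.span_zero show ?case by (simp only: tensor_def vs.select_convs) blast
  next
    case (step c x y)
    then obtain v w where "x = pure V W v w" "v \<in> vs_carrier V" "w \<in> vs_carrier W" by auto
    moreover from this step have "fun_scale c x + y \<in> vs_carrier (tensor V W)"
      using is_vs_add[OF is_vs_tensor] is_vs_scale[OF is_vs_tensor, of _ V W c] pure_in_tensor
      by (metis (no_types, lifting) tensor_def vs.select_convs(2))
    ultimately show ?case using step assms(3) by blast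
  qed
  then show ?thesis by simp
qed

lemma bilinear_on_pure:
  assumes "is_vs V" "is_vs W"
  shows "bilinear_on V W (tensor V W) (pure V W)"
  unfolding bilinear_on_def linear_on_def
  by (auto intro: pure_in_tensor)
     (auto simp: pure_def fun_eq_iff tensor_def fun_scale_def bilinear_on_def linear_on_def base_field_def)

lemma tensor_assoc_pure:
  assumes "is_vs U" "is_vs V" "is_vs W" "u \<in> vs_carrier U" "v \<in> vs_carrier V" "w \<in> vs_carrier W"
  shows "tensor_assoc U V W (pure (tensor U V) W (pure U V u v) w) = pure U (tensor V W) u (pure V W v w)"
proof
  fix B :: "'b \<Rightarrow> ('a, 'c, 'd) tensor \<Rightarrow> 'a"
  show "tensor_assoc U V W (pure (tensor U V) W (pure U V u v) w) B =
        pure U (tensor V W) u (pure V W v w) B"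
  proof (cases "bilinear_on U (tensor V W) base_field B")
    case False
    then show ?thesis by (simp add: tensor_assoc_def pure_def)
  next
    case B: True
    have pv: "linear_on V (tensor V W) (\<lambda>v. pure V W v w)" if "w \<in> vs_carrier W" for w
      using bilinear_on_pure[OF assms(2,3)] that by (simp add: bilinear_on_def)
    have pw: "linear_on W (tensor V W) (pure V W v)" if "v \<in> vs_carrier V" for v
      using bilinear_on_pure[OF assms(2,3)] that by (simp add: bilinear_on_def)
    have b1: "bilinear_on U V base_field (\<lambda>u v. B u (pure V W v w))" if "w \<in> vs_carrier W" for w
      using bilinear_on_comp[OF B _ pv[OF that], of U "\<lambda>u. u"] by (simp add: linear_on_def)
    have "linear_on W base_field (\<lambda>w. s (\<lambda>u v. B u (pure V W v w)))"
      if "s \<in> vs_carrier (tensor U V)" for s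
      using that
    proof (induction rule: tensor_induct)
      case zero
      show ?case by (simp add: linear_on_def base_field_def)
    next
      case (pure c u v t)
      have "linear_on W base_field (\<lambda>w. B u (pure V W v w))"
        using B pure(1) by (intro linear_on_comp[OF pw[OF pure(2)]]) (simp add: bilinear_on_def)
      with pure(4) show ?case
        using b1 is_vs_add[OF assms(3)] is_vs_scale[OF assms(3)]
        by (simp add: linear_on_def base_field_def pure_def fun_scale_def algebra_simps)
    qed
    moreover have "linear_on (tensor U V) base_field (\<lambda>s. s (\<lambda>u v. B u (pure V W v w)))" for w
      by (simp add: linear_on_def base_field_def tensor_def fun_scale_def)
    ultimately have "bilinear_on (tensor U V) W base_field (\<lambda>s w. s (\<lambda>u v. B u (pure V W v w)))"
      by (simp add: bilinear_on_def)
    with B b1[OF assms(6)] show ?thesis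
      by (simp add: tensor_assoc_def pure_def[of "tensor U V"] pure_def[of U V] pure_def[of U "tensor V W"])
  qed
qed

text \<open>Uniqueness of the factorising map on the carrier is immediate from \<open>tensor_induct\<close>.\<close>

lemma tensor_universal:
  fixes V :: "('k::field, 'a::ab_group_add) vs" and W :: "('k, 'b::ab_group_add) vs"
    and U :: "('k, 'c::ab_group_add) vs"
  assumes "is_vs V" "is_vs W" "is_vs U" and \<phi>: "bilinear_on V W U \<phi>"
  obtains L where "linear_on (tensor V W) U L"
    and "\<And>v w. v \<in> vs_carrier V \<Longrightarrow> w \<in> vs_carrier W \<Longrightarrow> L (pure V W v w) = \<phi> v w"
proof -
  interpret U: vector_space "vs_scale U" using assms(3) by (simp add: is_vs_def)
  interpret K: vector_space "(*) :: 'k \<Rightarrow> 'k \<Rightarrow> 'k" by unfold_locales (auto simp: algebra_simps)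
  interpret UK: vector_space_pair "vs_scale U" "(*) :: 'k \<Rightarrow> 'k \<Rightarrow> 'k" ..
  have U: "U.subspace (vs_carrier U)" using assms(3) by (simp add: is_vs_def)
  define dual where "dual l \<longleftrightarrow> Vector_Spaces.linear (vs_scale U) (*) l" for l
  have sep: "x = y" if "\<And>l. dual l \<Longrightarrow> l x = l y" for x y
  proof (rule ccontr)
    assume "x \<noteq> y"
    then have "U.independent {x - y}" by (simp add: U.dependent_single)
    from UK.linear_independent_extend[OF this, of "\<lambda>_. 1"] obtain l
      where l: "Vector_Spaces.linear (vs_scale U) (*) l" "l (x - y) = 1" by auto
    then interpret l: Vector_Spaces.linear "vs_scale U" "(*)" l by simp
    from l that[of l] show False by (simp add: dual_def l.diff)
  qed
  define R where "R t z \<longleftrightarrow> z \<in> vs_carrier U \<and> (\<forall>l. dual l \<longrightarrow> l z = t (\<lambda>v w. l (\<phi> v w)))" for t z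
  have dadd: "l (x + y) = l x + l y" and dscale: "l (vs_scale U c x) = c * l x" if "dual l" for l c x y
    using that unfolding dual_def Vector_Spaces.linear_iff by blast+
  have dbil: "bilinear_on V W base_field (\<lambda>v w. l (\<phi> v w))" if "dual l" for l
    using \<phi> dadd[OF that] dscale[OF that] by (simp add: bilinear_on_def linear_on_def base_field_def)
  have uniq: "z = z'" if "R t z" "R t z'" for t z z'
    using that unfolding R_def by (intro sep) metis
  have Rpure: "R (pure V W v w) (\<phi> v w)" if "v \<in> vs_carrier V" "w \<in> vs_carrier W" for v w
    using that \<phi> dbil by (auto simp: R_def pure_def bilinear_on_def linear_on_def)
  have Radd: "R (s + t) (x + y)" if "R s x" "R t y" for s t x y
    using that U.subspace_add[OF U] by (simp add: R_def dadd)
  have Rscale: "R (fun_scale c t) (vs_scale U c x)" if "R t x" for c t x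
    using that U.subspace_scale[OF U] by (simp add: R_def dscale fun_scale_def)
  have ex: "\<exists>z. R t z" if "t \<in> vs_carrier (tensor V W)" for t
    using that
  proof (induction rule: tensor_induct)
    case zero
    have "R 0 0" using U.subspace_0[OF U] dscale[of _ 0 0] by (simp add: R_def)
    then show ?case ..
  next
    case (pure c v w t)
    then show ?case using Radd Rscale Rpure by meson
  qed
  define L where "L t = (THE z. R t z)" for t
  have LR: "L t = z" if "R t z" for t z
    unfolding L_def using that uniq by blast
  have RL: "R t (L t)" if "t \<in> vs_carrier (tensor V W)" for t
    using ex[OF that] LR by auto
  show thesis
  proof (rule that[of L])
    show "linear_on (tensor V W) U L"
      unfolding linear_on_def
      using RL LR[OF Radd[OF RL RL]] LR[OF Rscale[OF RL]]
      by (auto simp: R_def) (simp add: tensor_def)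
    show "L (pure V W v w) = \<phi> v w" if "v \<in> vs_carrier V" "w \<in> vs_carrier W" for v w
      using LR Rpure that by blast
  qed
qed


section \<open>BiHom-algebras and right BiHom-modules\<close>

text \<open>Linear maps out of \<open>G \<otimes> G\<close> and \<open>M \<otimes> G\<close> are given as bilinear maps.\<close>

locale bihom_algebra = vector_space scale
  for scale :: "'k::field_char_0 \<Rightarrow> 'g::ab_group_add \<Rightarrow> 'g" +
  fixes \<mu> :: "'g \<Rightarrow> 'g \<Rightarrow> 'g" and \<alpha> \<beta> :: "'g \<Rightarrow> 'g"
  assumes mult_linear_right: "Vector_Spaces.linear scale scale (\<lambda>h. \<mu> g h)"
    and mult_linear_left: "Vector_Spaces.linear scale scale (\<lambda>g. \<mu> g h)"
    and \<alpha>_linear: "Vector_Spaces.linear scale scale \<alpha>"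
    and \<beta>_linear: "Vector_Spaces.linear scale scale \<beta>"
    and \<alpha>_\<beta>_commute: "\<alpha> \<circ> \<beta> = \<beta> \<circ> \<alpha>"
    and bihom_assoc: "\<mu> (\<alpha> g) (\<mu> h k) = \<mu> (\<mu> g h) (\<beta> k)"
    and \<alpha>_mult: "\<alpha> (\<mu> h k) = \<mu> (\<alpha> h) (\<alpha> k)"
    and \<beta>_mult: "\<beta> (\<mu> h k) = \<mu> (\<beta> h) (\<beta> k)"

locale bihom_module =
  bihom_algebra scaleG \<mu> \<alpha> \<beta> + M: vector_space scaleM
  for scaleG :: "'k::field_char_0 \<Rightarrow> 'g::ab_group_add \<Rightarrow> 'g"
    and \<mu> :: "'g \<Rightarrow> 'g \<Rightarrow> 'g" and \<alpha> \<beta> :: "'g \<Rightarrow> 'g"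
    and scaleM :: "'k \<Rightarrow> 'm::ab_group_add \<Rightarrow> 'm" +
  fixes \<rho> :: "'m \<Rightarrow> 'g \<Rightarrow> 'm" and \<kappa> \<tau> :: "'m \<Rightarrow> 'm"
  assumes act_linear_right: "Vector_Spaces.linear scaleG scaleM (\<lambda>g. \<rho> m g)"
    and act_linear_left: "Vector_Spaces.linear scaleM scaleM (\<lambda>m. \<rho> m g)"
    and \<kappa>_linear: "Vector_Spaces.linear scaleM scaleM \<kappa>"
    and \<tau>_linear: "Vector_Spaces.linear scaleM scaleM \<tau>"
    and \<kappa>_\<tau>_commute: "\<kappa> \<circ> \<tau> = \<tau> \<circ> \<kappa>"
    and act_assoc: "\<rho> (\<rho> m g) (\<beta> h) = \<rho> (\<kappa> m) (\<mu> g h)"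
    and \<kappa>_act: "\<rho> (\<kappa> m) (\<alpha> g) = \<kappa> (\<rho> m g)"
    and \<tau>_act: "\<rho> (\<tau> m) (\<beta> g) = \<tau> (\<rho> m g)"

locale bihom_module_morphism =
  M: bihom_module scaleG \<mu> \<alpha> \<beta> scaleM \<rho> \<kappa> \<tau> + N: bihom_module scaleG \<mu> \<alpha> \<beta> scaleN \<rho>' \<kappa>' \<tau>'
  for scaleG :: "'k::field_char_0 \<Rightarrow> 'g::ab_group_add \<Rightarrow> 'g"
    and \<mu> :: "'g \<Rightarrow> 'g \<Rightarrow> 'g" and \<alpha> \<beta> :: "'g \<Rightarrow> 'g"
    and scaleM :: "'k \<Rightarrow> 'm::ab_group_add \<Rightarrow> 'm"
    and \<rho> :: "'m \<Rightarrow> 'g \<Rightarrow> 'm" and \<kappa> \<tau> :: "'m \<Rightarrow> 'm"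
    and scaleN :: "'k \<Rightarrow> 'n::ab_group_add \<Rightarrow> 'n"
    and \<rho>' :: "'n \<Rightarrow> 'g \<Rightarrow> 'n" and \<kappa>' \<tau>' :: "'n \<Rightarrow> 'n" +
  fixes \<sigma> :: "'m \<Rightarrow> 'n"
  assumes \<sigma>_linear: "Vector_Spaces.linear scaleM scaleN \<sigma>"
    and \<sigma>_act: "\<sigma> (\<rho> m g) = \<rho>' (\<sigma> m) g"
    and \<sigma>_\<kappa>: "\<kappa>' \<circ> \<sigma> = \<sigma> \<circ> \<kappa>"
    and \<sigma>_\<tau>: "\<tau>' \<circ> \<sigma> = \<sigma> \<circ> \<tau>"


section \<open>BiHom-coalgebras and right BiHom-comodules\<close>

locale bihom_coalgebra =
  fixes C :: "('k::field_char_0, 'c::ab_group_add) vs"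
    and \<Delta> :: "'c \<Rightarrow> ('k, 'c, 'c) tensor" and \<psi> \<phi> :: "'c \<Rightarrow> 'c"
  assumes C_vs: "is_vs C"
    and \<Delta>_linear: "linear_on C (tensor C C) \<Delta>"
    and \<psi>_linear: "linear_on C C \<psi>"
    and \<phi>_linear: "linear_on C C \<phi>"
    and \<psi>_\<phi>_commute: "x \<in> vs_carrier C \<Longrightarrow> \<psi> (\<phi> x) = \<phi> (\<psi> x)"
    and coassoc: "x \<in> vs_carrier C \<Longrightarrow>
      tensor_map C (tensor C C) \<phi> \<Delta> (\<Delta> x) =
      tensor_assoc C C C (tensor_map (tensor C C) C \<Delta> \<psi> (\<Delta> x))"
    and \<Delta>_\<psi>: "x \<in> vs_carrier C \<Longrightarrow> \<Delta> (\<psi> x) = tensor_map C C \<psi> \<psi> (\<Delta> x)"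
    and \<Delta>_\<phi>: "x \<in> vs_carrier C \<Longrightarrow> \<Delta> (\<phi> x) = tensor_map C C \<phi> \<phi> (\<Delta> x)"

locale bihom_comodule = bihom_coalgebra C \<Delta> \<psi> \<phi>
  for C :: "('k::field_char_0, 'c::ab_group_add) vs"
    and \<Delta> :: "'c \<Rightarrow> ('k, 'c, 'c) tensor" and \<psi> \<phi> :: "'c \<Rightarrow> 'c" +
  fixes A :: "('k, 'a::ab_group_add) vs"
    and \<gamma> :: "'a \<Rightarrow> ('k, 'a, 'c) tensor" and \<omega> \<theta> :: "'a \<Rightarrow> 'a"
  assumes A_vs: "is_vs A"
    and \<gamma>_linear: "linear_on A (tensor A C) \<gamma>"
    and \<omega>_linear: "linear_on A A \<omega>"
    and \<theta>_linear: "linear_on A A \<theta>"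
    and \<omega>_\<theta>_commute: "x \<in> vs_carrier A \<Longrightarrow> \<omega> (\<theta> x) = \<theta> (\<omega> x)"
    and coact_assoc: "x \<in> vs_carrier A \<Longrightarrow>
      tensor_assoc A C C (tensor_map (tensor A C) C \<gamma> \<psi> (\<gamma> x)) =
      tensor_map A (tensor C C) \<theta> \<Delta> (\<gamma> x)"
    and \<omega>_coact: "x \<in> vs_carrier A \<Longrightarrow> tensor_map A C \<omega> \<psi> (\<gamma> x) = \<gamma> (\<omega> x)"
    and \<theta>_coact: "x \<in> vs_carrier A \<Longrightarrow> tensor_map A C \<theta> \<phi> (\<gamma> x) = \<gamma> (\<theta> x)"

locale bihom_comodule_morphism =
  A: bihom_comodule C \<Delta> \<psi> \<phi> A \<gamma> \<omega> \<theta> + A': bihom_comodule C \<Delta> \<psi> \<phi> A' \<gamma>' \<omega>' \<theta>'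
  for C :: "('k::field_char_0, 'c::ab_group_add) vs"
    and \<Delta> :: "'c \<Rightarrow> ('k, 'c, 'c) tensor" and \<psi> \<phi> :: "'c \<Rightarrow> 'c"
    and A :: "('k, 'a::ab_group_add) vs"
    and \<gamma> :: "'a \<Rightarrow> ('k, 'a, 'c) tensor" and \<omega> \<theta> :: "'a \<Rightarrow> 'a"
    and A' :: "('k, 'b::ab_group_add) vs"
    and \<gamma>' :: "'b \<Rightarrow> ('k, 'b, 'c) tensor" and \<omega>' \<theta>' :: "'b \<Rightarrow> 'b" +
  fixes f :: "'a \<Rightarrow> 'b"
  assumes f_linear: "linear_on A A' f"
    and f_coact: "x \<in> vs_carrier A \<Longrightarrow> \<gamma>' (f x) = tensor_map A' C f (\<lambda>c. c) (\<gamma> x)"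
    and f_\<omega>: "x \<in> vs_carrier A \<Longrightarrow> \<omega>' (f x) = f (\<omega> x)"
    and f_\<theta>: "x \<in> vs_carrier A \<Longrightarrow> \<theta>' (f x) = f (\<theta> x)"


section \<open>Sweedler duals\<close>

definition bihom_ideal ::
  "('k::field \<Rightarrow> 'g::ab_group_add \<Rightarrow> 'g) \<Rightarrow> ('g \<Rightarrow> 'g \<Rightarrow> 'g) \<Rightarrow> ('g \<Rightarrow> 'g) \<Rightarrow> ('g \<Rightarrow> 'g) \<Rightarrow> 'g set \<Rightarrow> bool" where
  "bihom_ideal sG \<mu> \<alpha> \<beta> H \<longleftrightarrow>
     module.subspace sG H \<and> \<alpha> ` H \<subseteq> H \<and> \<beta> ` H \<subseteq> H \<and>
     (\<forall>a. \<forall>b\<in>H. \<mu> a b \<in> H \<and> \<mu> b a \<in> H)"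

text \<open>\<open>dim (G/H) < \<infinity>\<close>: the cosets of finitely many elements of \<open>G\<close> span \<open>G/H\<close>.\<close>

definition finite_codim :: "('k::field \<Rightarrow> 'g::ab_group_add \<Rightarrow> 'g) \<Rightarrow> 'g set \<Rightarrow> bool" where
  "finite_codim sG H \<longleftrightarrow> (\<exists>B. finite B \<and> (\<forall>x. \<exists>b\<in>module.span sG B. x - b \<in> H))"

definition mod_mult ::
  "('k::field \<Rightarrow> 'm::ab_group_add \<Rightarrow> 'm) \<Rightarrow> ('m \<Rightarrow> 'g \<Rightarrow> 'm) \<Rightarrow> 'g set \<Rightarrow> 'm set" where
  "mod_mult sM \<rho> J = module.span sM {\<rho> m j |m j. j \<in> J}"

definition sweedler_alg ::
  "('k::field \<Rightarrow> 'g::ab_group_add \<Rightarrow> 'g) \<Rightarrow> ('g \<Rightarrow> 'g \<Rightarrow> 'g) \<Rightarrow> ('g \<Rightarrow> 'g) \<Rightarrow> ('g \<Rightarrow> 'g)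
     \<Rightarrow> ('k, 'g \<Rightarrow> 'k) vs" where
  "sweedler_alg sG \<mu> \<alpha> \<beta> =
     \<lparr>vs_carrier = {f. Vector_Spaces.linear sG (*) f \<and>
        (\<exists>J. bihom_ideal sG \<mu> \<alpha> \<beta> J \<and> finite_codim sG J \<and> (\<forall>x\<in>J. f x = 0))},
      vs_scale = fun_scale\<rparr>"

definition sweedler_mod ::
  "('k::field \<Rightarrow> 'g::ab_group_add \<Rightarrow> 'g) \<Rightarrow> ('g \<Rightarrow> 'g \<Rightarrow> 'g) \<Rightarrow> ('g \<Rightarrow> 'g) \<Rightarrow> ('g \<Rightarrow> 'g)
     \<Rightarrow> ('k \<Rightarrow> 'm::ab_group_add \<Rightarrow> 'm) \<Rightarrow> ('m \<Rightarrow> 'g \<Rightarrow> 'm) \<Rightarrow> ('k, 'm \<Rightarrow> 'k) vs" where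
  "sweedler_mod sG \<mu> \<alpha> \<beta> sM \<rho> =
     \<lparr>vs_carrier = {f. Vector_Spaces.linear sM (*) f \<and>
        (\<exists>J. bihom_ideal sG \<mu> \<alpha> \<beta> J \<and> finite_codim sG J \<and> (\<forall>x\<in>mod_mult sM \<rho> J. f x = 0))},
      vs_scale = fun_scale\<rparr>"

text \<open>
  \<open>dual_embed\<close> is the embedding of \<open>U\<^sup>* \<otimes> V\<^sup>*\<close> into \<open>(U \<otimes> V)\<^sup>*\<close>, the latter being the bilinear
  forms on \<open>U \<times> V\<close>; it sends the elementary tensor of \<open>f\<close> and \<open>g\<close> to \<open>\<lambda>x y. f x * g y\<close>
  (lemma \<open>dual_embed_pure\<close>). For subspaces \<open>P\<close> of \<open>U\<^sup>*\<close> and \<open>Q\<close> of \<open>V\<^sup>*\<close>, \<open>dual_comap P Q r \<xi>\<close> is the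
  form \<open>\<xi> \<circ> r\<close> regarded as an element of \<open>P \<otimes> Q\<close>, which is unique because the
  embedding is injective.
\<close>

definition dual_embed :: "('k::field, 'x \<Rightarrow> 'k, 'y \<Rightarrow> 'k) tensor \<Rightarrow> 'x \<Rightarrow> 'y \<Rightarrow> 'k" where
  "dual_embed t = (\<lambda>x y. t (\<lambda>f g. f x * g y))"

definition dual_comap ::
  "('k::field, 'x \<Rightarrow> 'k) vs \<Rightarrow> ('k, 'y \<Rightarrow> 'k) vs \<Rightarrow> ('x \<Rightarrow> 'y \<Rightarrow> 'z) \<Rightarrow> ('z \<Rightarrow> 'k)
     \<Rightarrow> ('k, 'x \<Rightarrow> 'k, 'y \<Rightarrow> 'k) tensor" where
  "dual_comap P Q r \<xi> =
     (THE t. t \<in> vs_carrier (tensor P Q) \<and> dual_embed t = (\<lambda>x y. \<xi> (r x y)))"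

lemma dual_embed_pure:
  assumes "vs_scale P = fun_scale" "vs_scale Q = fun_scale"
  shows "dual_embed (pure P Q f g) = (\<lambda>x y. f x * g y)"
proof -
  have "bilinear_on P Q base_field (\<lambda>f g. f x * g y)" for x y
    using assms by (simp add: bilinear_on_def linear_on_def base_field_def fun_scale_def algebra_simps)
  then show ?thesis by (simp add: dual_embed_def pure_def)
qed

abbreviation pullback :: "('a \<Rightarrow> 'b) \<Rightarrow> ('b \<Rightarrow> 'k) \<Rightarrow> 'a \<Rightarrow> 'k" where
  "pullback h \<equiv> (\<lambda>f. f \<circ> h)"

abbreviation sweedler_comult where
  "sweedler_comult sG \<mu> \<alpha> \<beta> \<equiv>
     dual_comap (sweedler_alg sG \<mu> \<alpha> \<beta>) (sweedler_alg sG \<mu> \<alpha> \<beta>) \<mu>"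

abbreviation sweedler_coact where
  "sweedler_coact sG \<mu> \<alpha> \<beta> sM \<rho> \<equiv>
     dual_comap (sweedler_mod sG \<mu> \<alpha> \<beta> sM \<rho>) (sweedler_alg sG \<mu> \<alpha> \<beta>) \<rho>"

end

theory Submission
  imports Defs
begin

text \<open>
  Let \<open>\<xi>\<close> be a functional on \<open>M\<close> that vanishes on \<open>M \<cdot> J\<close> for a finite-codimensional ideal \<open>J\<close>.
  The form \<open>\<xi>(m \<cdot> g)\<close> has rows in \<open>G\<^sup>\<circ>\<close>, and its columns span a finite-dimensional space since
  they depend only on \<open>g\<close> modulo \<open>J\<close>. The columns lie in \<open>M\<^sup>\<circ>\<close> because \<open>g = \<beta>(h)\<close> gives
  \<open>(m \<cdot> j) \<cdot> g = \<kappa>(m) \<cdot> (j h)\<close>; this is where surjectivity of \<open>\<beta>\<close> enters. A form of finite rank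
  with rows in \<open>Q\<close> and columns in \<open>P\<close> comes from a unique element of \<open>P \<otimes> Q\<close>, so the coaction is
  defined, and every axiom may be checked after embedding the tensor products into spaces of
  forms, where it is the transpose of an axiom of the algebra or module, or of the
  compatibility of \<open>\<sigma>\<close> with the actions.
\<close>

section \<open>Ideals of finite codimension\<close>

context vector_space
begin

lemma finite_spanning_modulo_subspace:
  assumes "finite B" "subspace A" "subspace H" "\<And>x. x \<in> A \<Longrightarrow> \<exists>b\<in>span B. x - b \<in> H"
  shows "\<exists>C. finite C \<and> C \<subseteq> A \<and> (\<forall>x\<in>A. \<exists>c\<in>span C. x - c \<in> H)"
  using assms(1,3,4)
proof (induction B arbitrary: H rule: finite_induct)
  case empty
  then show ?case by (intro exI[of _ "{}"]) auto
next
  case (insert b B)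
  show ?case
  proof (cases "\<forall>x\<in>A. \<exists>s\<in>span B. x - s \<in> H")
    case True
    with insert.IH[OF insert.prems(1)] show ?thesis by blast
  next
    case False
    then obtain a where a: "a \<in> A" "\<And>s. s \<in> span B \<Longrightarrow> a - s \<notin> H" by blast
    from insert.prems(2)[OF a(1)] obtain u where u: "u \<in> span (insert b B)" "a - u \<in> H" by blast
    from u(1) obtain k where k: "u - k *s b \<in> span B" by (auto simp: span_insert)
    \<comment> \<open>Were \<open>k\<close> zero, \<open>u\<close> would lie in
      \<open>span B\<close>, against the choice of \<open>a\<close>.\<close>
    have k0: "k \<noteq> 0" using a(2)[of u] k u(2) by auto
    have H': "x \<in> span (insert a H) \<longleftrightarrow> (\<exists>c. x - c *s a \<in> H)" for x
      using insert.prems(1) by (simp add: span_insert span_eq_iff[THEN iffD2])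
    have "\<exists>s\<in>span B. x - s \<in> span (insert a H)" if "x \<in> A" for x
    proof -
      from insert.prems(2)[OF that] obtain v where v: "v \<in> span (insert b B)" "x - v \<in> H" by blast
      from v(1) obtain l where l: "v - l *s b \<in> span B" by (auto simp: span_insert)
      \<comment> \<open>Elimination of \<open>b\<close>: both brackets lie in \<open>span B\<close>,
        and their combination is congruent to \<open>x\<close> modulo \<open>H\<close> up to the
        multiple \<open>l / k\<close> of \<open>a\<close>.\<close>
      let ?s = "(v - l *s b) - (l / k) *s (u - k *s b)"
      have s: "?s = v - (l / k) *s u" using k0 by (simp add: algebra_simps)
      have "x - ?s - (l / k) *s a = (x - v) - (l / k) *s (a - u)"
        unfolding s by (simp add: algebra_simps)
      also have "\<dots> \<in> H" by (intro subspace_diff subspace_scale insert.prems(1) v(2) u(2))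
      finally have "x - ?s \<in> span (insert a H)" unfolding H' by blast
      moreover have "?s \<in> span B" by (intro span_diff span_scale l k)
      ultimately show ?thesis by blast
    qed
    from insert.IH[OF subspace_span this] obtain C
      where C: "finite C" "C \<subseteq> A" "\<And>x. x \<in> A \<Longrightarrow> \<exists>c\<in>span C. x - c \<in> span (insert a H)" by blast
    have "\<exists>c\<in>span (insert a C). x - c \<in> H" if "x \<in> A" for x
    proof -
      from C(3)[OF that] obtain c l where c: "c \<in> span C" "x - c - l *s a \<in> H" by (auto simp: H')
      have "c \<in> span (insert a C)" using c(1) span_mono[of C "insert a C"] by auto
      then have "c + l *s a \<in> span (insert a C)" by (auto intro: span_add span_scale span_base)
      with c(2) show ?thesis by (intro bexI[of _ "c + l *s a"]) (simp_all add: algebra_simps)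
    qed
    with C(1,2) a(1) show ?thesis by (intro exI[of _ "insert a C"]) auto
  qed
qed

text \<open>The quotient of \<open>H\<close> by \<open>H \<inter> K\<close> embeds into the
  finite-dimensional quotient by \<open>K\<close>. Representatives for it, together with those for
  the quotient by \<open>H\<close>, span everything modulo \<open>H \<inter> K\<close>.\<close>

lemma finite_codim_Int:
  assumes "subspace H" "subspace K" "finite_codim scale H" "finite_codim scale K"
  shows "finite_codim scale (H \<inter> K)"
proof -
  from assms(3) obtain B where B: "finite B" "\<And>x. \<exists>b\<in>span B. x - b \<in> H"
    by (auto simp: finite_codim_def)
  from assms(4) obtain B' where "finite B'" "\<And>x. \<exists>b\<in>span B'. x - b \<in> K"
    by (auto simp: finite_codim_def)
  from finite_spanning_modulo_subspace[OF this(1) assms(1,2) this(2)] obtain C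
    where C: "finite C" "C \<subseteq> H" "\<And>x. x \<in> H \<Longrightarrow> \<exists>c\<in>span C. x - c \<in> K" by blast
  have "\<exists>b\<in>span (B \<union> C). x - b \<in> H \<inter> K" for x
  proof -
    from B(2) obtain b where b: "b \<in> span B" "x - b \<in> H" by blast
    with C(3) obtain c where c: "c \<in> span C" "x - b - c \<in> K" by blast
    \<comment> \<open>The correction modulo \<open>K\<close> is made of elements of
      \<open>H\<close>, so it does not spoil the congruence modulo \<open>H\<close>.\<close>
    have "c \<in> H" using c(1) span_minimal[OF C(2) assms(1)] by blast
    with b(2) have "x - b - c \<in> H" using subspace_diff[OF assms(1)] by blast
    moreover have "b + c \<in> span (B \<union> C)"
      using b(1) c(1) by (auto simp: span_Un)
    ultimately show ?thesis using c(2) by (intro bexI[of _ "b + c"]) (auto simp: diff_diff_eq)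
  qed
  with B(1) C(1) show ?thesis unfolding finite_codim_def by (intro exI[of _ "B \<union> C"]) auto
qed

lemma bihom_ideal_Int:
  "bihom_ideal scale \<mu> \<alpha> \<beta> H \<Longrightarrow> bihom_ideal scale \<mu> \<alpha> \<beta> K \<Longrightarrow> bihom_ideal scale \<mu> \<alpha> \<beta> (H \<inter> K)"
  unfolding bihom_ideal_def by (auto simp: subspace_inter)

lemma bihom_ideal_UNIV: "bihom_ideal scale \<mu> \<alpha> \<beta> UNIV"
  by (simp add: bihom_ideal_def)

lemma finite_codim_UNIV: "finite_codim scale UNIV"
  unfolding finite_codim_def by (intro exI[of _ "{}"]) auto

end


section \<open>Tensor products of function spaces\<close>

text \<open>Pointwise scaling makes evaluation at a point a linear functional on \<open>P\<close>.
  The products of such evaluations are the bilinear forms at which \<open>dual_embed\<close> reads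
  off a tensor.\<close>

definition function_space :: "('k::field, 'x \<Rightarrow> 'k) vs \<Rightarrow> bool" where
  "function_space P \<longleftrightarrow> is_vs P \<and> vs_scale P = fun_scale"

lemma function_space_iff:
  "function_space P \<longleftrightarrow> vs_scale P = fun_scale \<and> FS.subspace (vs_carrier P)"
  by (auto simp: function_space_def is_vs_def vector_space_fun_scale)

lemma function_space_tensor: "function_space (tensor V W)"
  using is_vs_tensor[of V W] by (simp add: function_space_def tensor_def)

lemma linear_functional_sum:
  assumes V: "is_vs V" and f: "linear_on V base_field f" and x: "\<And>i. i \<in> I \<Longrightarrow> x i \<in> vs_carrier V"
  shows "f (\<Sum>i\<in>I. vs_scale V (a i) (x i)) = (\<Sum>i\<in>I. a i * f (x i))"
proof -
  interpret V: vector_space "vs_scale V" using V by (simp add: is_vs_def)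
  have sub: "V.subspace (vs_carrier V)" using V by (simp add: is_vs_def)
  have zero: "f 0 = 0"
    using linear_on_scale[OF f V.subspace_0[OF sub], of 0] by (simp add: base_field_def)
  show ?thesis
    using x
  proof (induction I rule: infinite_finite_induct)
    case (insert i I)
    then have "(\<Sum>i\<in>I. vs_scale V (a i) (x i)) \<in> vs_carrier V" "vs_scale V (a i) (x i) \<in> vs_carrier V"
      by (intro V.subspace_sum V.subspace_scale sub; simp)+
    with insert linear_on_scale[OF f, of "x i" "a i"] show ?case
      by (simp add: linear_on_add[OF f] base_field_def)
  \<comment> \<open>For infinite \<open>I\<close> both sums default to 0, so this case, like the
    empty one, is \<open>f 0 = 0\<close>.\<close>
  qed (simp_all add: zero)
qed

lemma linear_functional_zero: "is_vs V \<Longrightarrow> linear_on V base_field f \<Longrightarrow> f 0 = 0"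
  using linear_functional_sum[of V f "{}"] by simp

text \<open>
  A finite-dimensional space of functions has a basis \<open>F x\<close> dual to evaluation at finitely many
  points \<open>x \<in> S\<close>.
\<close>

lemma finite_interpolation:
  fixes B :: "('x \<Rightarrow> 'k::field) set"
  assumes "finite B"
  shows "\<exists>S F. finite S \<and> (\<forall>x\<in>S. F x \<in> FS.span B) \<and> (\<forall>x\<in>S. \<forall>y\<in>S. F x y = of_bool (x = y)) \<and>
    (\<forall>f\<in>FS.span B. \<forall>z. f z = (\<Sum>x\<in>S. f x * F x z))"
  using assms
proof (induction rule: finite_induct)
  case empty
  show ?case by (intro exI[of _ "{}"]) auto
next
  case (insert b B)
  then obtain S and F :: "'x \<Rightarrow> 'x \<Rightarrow> 'k"
    where S: "finite S" and "\<forall>x\<in>S. F x \<in> FS.span B"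
      and "\<forall>x\<in>S. \<forall>y\<in>S. F x y = of_bool (x = y)"
      and "\<forall>f\<in>FS.span B. \<forall>z. f z = (\<Sum>x\<in>S. f x * F x z)"
    by (elim exE conjE) (rule that)
  note F = this(2)[rule_format] and \<delta> = this(3)[rule_format] and rep = this(4)[rule_format]
  \<comment> \<open>\<open>p\<close> interpolates \<open>b\<close> at the nodes in \<open>S\<close>;
    the residual \<open>h\<close> below vanishes on \<open>S\<close> and measures what
    \<open>b\<close> adds to the span.\<close>
  define p where "p = (\<Sum>x\<in>S. fun_scale (b x) (F x))"
  have pz: "p z = (\<Sum>x\<in>S. b x * F x z)" for z
    unfolding p_def using S by (induction S rule: finite_induct) (auto simp: fun_scale_def)
  have p: "p \<in> FS.span B" unfolding p_def by (intro FS.span_sum FS.span_scale F)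
  have mono: "FS.span B \<subseteq> FS.span (insert b B)" by (intro FS.span_mono) auto
  define h where "h = b - p"
  have h: "h \<in> FS.span (insert b B)"
    unfolding h_def using p mono by (intro FS.span_diff) (auto intro: FS.span_base)
  show ?case
  proof (cases "h = 0")
    case True
    then have "b \<in> FS.span B" using p by (simp add: h_def)
    then have "FS.span (insert b B) = FS.span B" by (rule FS.span_redundant)
    with insert.IH show ?thesis by (simp only:)
  next
    case False
    \<comment> \<open>Any point where the residual is nonzero serves as the new node.\<close>
    then obtain z where z: "h z \<noteq> 0" by (auto simp: fun_eq_iff)
    have hS: "h x = 0" if "x \<in> S" for x
    proof -
      have "p x = (\<Sum>y\<in>S. if y = x then b y else 0)"
        unfolding pz using \<delta> that by (intro sum.cong) auto
      with S that show ?thesis by (simp add: h_def)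
    qed
    with z have zS: "z \<notin> S" by auto
    define E where "E = fun_scale (inverse (h z)) h"
    \<comment> \<open>\<open>E\<close> is the residual normalised to 1 at \<open>z\<close>.
      Subtracting multiples of it makes the old basis vanish at \<open>z\<close> without changing it
      on \<open>S\<close>.\<close>
    define F' where "F' x = (if x = z then E else F x - fun_scale (F x z) E)" for x
    have Ey: "E y = h y / h z" for y by (simp add: E_def fun_scale_def field_simps)
    have E: "E \<in> FS.span (insert b B)" unfolding E_def by (intro FS.span_scale h)
    have F': "F' x \<in> FS.span (insert b B)" if "x \<in> insert z S" for x
      using that E F mono by (auto simp: F'_def intro!: FS.span_diff FS.span_scale)
    have \<delta>': "F' x y = of_bool (x = y)" if "x \<in> insert z S" "y \<in> insert z S" for x y
      using that z zS hS \<delta> by (auto simp: F'_def Ey fun_scale_def)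
    have rep': "f y = (\<Sum>x\<in>insert z S. f x * F' x y)" if "f \<in> FS.span (insert b B)" for f y
    proof -
      from that obtain c where "f - fun_scale c b \<in> FS.span B" by (auto simp: FS.span_insert)
      then have "(f - fun_scale c b) + fun_scale c p \<in> FS.span B"
        by (intro FS.span_add FS.span_scale p)
      \<comment> \<open>Replacing \<open>b\<close> by \<open>p + h\<close> splits \<open>f\<close>
        into \<open>g\<close>, covered by the induction hypothesis, and \<open>c\<close> times the
        residual.\<close>
      moreover define g where "g = (f - fun_scale c b) + fun_scale c p"
      ultimately have g: "g \<in> FS.span B" by simp
      have f: "f x = g x + c * h x" for x
        by (simp add: g_def h_def fun_scale_def algebra_simps)
      have "(\<Sum>x\<in>S. f x * F' x y) = (\<Sum>x\<in>S. g x * F x y - g x * F x z * E y)"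
        using zS hS by (intro sum.cong) (auto simp: f F'_def fun_scale_def algebra_simps)
      also have "\<dots> = g y - g z * E y"
        by (simp add: sum_subtractf rep[OF g, of y] rep[OF g, of z] sum_distrib_right)
      finally have "(\<Sum>x\<in>insert z S. f x * F' x y) = f z * E y + g y - g z * E y"
        using S zS by (simp add: F'_def)
      also have "\<dots> = f y" using z by (simp add: f Ey field_simps)
      finally show ?thesis by simp
    qed
    show ?thesis
      by (intro exI[of _ "insert z S"] exI[of _ F'] conjI ballI allI)
        (use S in simp, (rule F' \<delta>' rep', assumption+)+)
  qed
qed

section \<open>Elements of tensor products under induced maps, reassociation and evaluation\<close>

lemma tensor_map_in_tensor:
  assumes "linear_on V V' f" "linear_on W W' g" "t \<in> vs_carrier (tensor V W)"
  shows "tensor_map V' W' f g t \<in> vs_carrier (tensor V' W')"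
  using assms(3)
proof (induction rule: tensor_induct)
  case zero
  have "tensor_map V' W' f g (0 :: ('a, 'b, 'd) tensor) = 0"
    by (simp add: tensor_map_def fun_eq_iff)
  then show ?case by (simp only: tensor_def vs.select_convs FS.span_zero)
next
  case (pure c v w t)
  have "tensor_map V' W' f g (fun_scale c (pure V W v w) + t) =
    fun_scale c (pure V' W' (f v) (g w)) + tensor_map V' W' f g t"
  proof
    fix B
    show "tensor_map V' W' f g (fun_scale c (pure V W v w) + t) B =
      (fun_scale c (pure V' W' (f v) (g w)) + tensor_map V' W' f g t) B"
      using fun_cong[OF tensor_map_pure[OF assms(1,2), of v w], of B]
      by (simp add: tensor_map_def fun_scale_def split: if_splits)
  qed
  moreover have "pure V' W' (f v) (g w) \<in> vs_carrier (tensor V' W')"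
    using pure(1,2) assms(1,2) by (intro pure_in_tensor) (auto dest: linear_on_in)
  ultimately show ?case
    using pure(4) by (simp only: tensor_def vs.select_convs FS.span_add FS.span_scale)
qed

text \<open>\<open>tensor_assoc_pure\<close> requires the left factor to be an elementary tensor
  too. Hence there are two inductions: the outer one reduces to an elementary tensor of
  \<open>s\<close> and \<open>w\<close>, the inner one expands \<open>s\<close>.\<close>

lemma tensor_assoc_in_tensor:
  assumes "is_vs U" "is_vs V" "is_vs W" "t \<in> vs_carrier (tensor (tensor U V) W)"
  shows "tensor_assoc U V W t \<in> vs_carrier (tensor U (tensor V W))"
proof -
  have add: "tensor_assoc U V W (fun_scale c s + t) = fun_scale c (tensor_assoc U V W s) + tensor_assoc U V W t"
    for c s t by (auto simp: tensor_assoc_def fun_eq_iff fun_scale_def)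
  have assoc_zero: "tensor_assoc U V W 0 = 0" by (auto simp: tensor_assoc_def fun_eq_iff)
  have tz: "0 \<in> vs_carrier (tensor U (tensor V W))" by (simp add: tensor_def FS.span_zero)
  have ta: "fun_scale c s + t \<in> vs_carrier (tensor U (tensor V W))"
    if "s \<in> vs_carrier (tensor U (tensor V W))" "t \<in> vs_carrier (tensor U (tensor V W))" for c s t
    using that by (simp add: tensor_def FS.span_add FS.span_scale)
  have sc: "vs_scale (tensor A B) = fun_scale"
    for A :: "('a, 'x::ab_group_add) vs" and B :: "('a, 'y::ab_group_add) vs"
    by (simp add: tensor_def)
  have assoc_pure: "tensor_assoc U V W (pure (tensor U V) W s w) \<in> vs_carrier (tensor U (tensor V W))"
    if s: "s \<in> vs_carrier (tensor U V)" and w: "w \<in> vs_carrier W" for s w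
  proof -
    have lin: "linear_on (tensor U V) (tensor (tensor U V) W) (\<lambda>s. pure (tensor U V) W s w)"
      using bilinear_on_pure[OF is_vs_tensor[of U V] assms(3)] w by (simp add: bilinear_on_def)
    show ?thesis
      using s
    proof (induction rule: tensor_induct)
      case zero
      have "0 \<in> vs_carrier (tensor U V)" by (simp add: tensor_def FS.span_zero)
      then have "pure (tensor U V) W 0 w = 0"
        using linear_on_scale[OF lin, of 0 0] unfolding sc by simp
      then show ?case by (simp only: assoc_zero tz)
    next
      case (pure c u v t)
      note uv = pure_in_tensor[OF pure(1,2)]
      have cuv: "fun_scale c (pure U V u v) \<in> vs_carrier (tensor U V)"
        using uv by (simp add: tensor_def FS.span_scale)
      have "pure (tensor U V) W (fun_scale c (pure U V u v) + t) w =
        fun_scale c (pure (tensor U V) W (pure U V u v) w) + pure (tensor U V) W t w"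
        using linear_on_add[OF lin cuv pure(3)] linear_on_scale[OF lin uv] unfolding sc by simp
      moreover have "pure U (tensor V W) u (pure V W v w) \<in> vs_carrier (tensor U (tensor V W))"
        by (intro pure_in_tensor pure(1,2) w)
      ultimately show ?case
        using pure(4) by (simp only: add tensor_assoc_pure[OF assms(1-3) pure(1,2) w] ta)
    qed
  qed
  show ?thesis
    using assms(4) by (induction rule: tensor_induct) (simp_all only: assoc_zero tz add ta assoc_pure)
qed

text \<open>A tensor is a function of forms on the full types, but it is a combination of
  evaluations at points of the carriers. This licenses rewriting a form by equations that hold only
  there.\<close>

lemma tensor_eval_cong:
  assumes "t \<in> vs_carrier (tensor V W)" "bilinear_on V W base_field B" "bilinear_on V W base_field B'"
    and "\<And>v w. v \<in> vs_carrier V \<Longrightarrow> w \<in> vs_carrier W \<Longrightarrow> B v w = B' v w"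
  shows "t B = t B'"
  using assms(1)
  by (induction rule: tensor_induct) (use assms(2-) in \<open>auto simp: pure_def fun_scale_def\<close>)

lemma linear_on_eval: "vs_scale P = fun_scale \<Longrightarrow> linear_on P base_field (\<lambda>f. f x)"
  by (simp add: linear_on_def base_field_def fun_scale_def)

lemma bilinear_on_mult: "bilinear_on base_field base_field base_field (\<lambda>x y. x * y)"
  by (simp add: bilinear_on_def linear_on_def base_field_def algebra_simps)

lemma bilinear_on_eval_mult:
  assumes "vs_scale P = fun_scale" "vs_scale Q = fun_scale"
  shows "bilinear_on P Q base_field (\<lambda>f g. f x * g y)"
  using bilinear_on_comp[OF bilinear_on_mult linear_on_eval[OF assms(1)] linear_on_eval[OF assms(2)]] .

section \<open>Injectivity and image of the embedding into bilinear forms\<close>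

lemma dual_embed_add: "dual_embed (s + t) = dual_embed s + dual_embed t"
  and dual_embed_fun_scale: "dual_embed (fun_scale c s) x y = c * dual_embed s x y"
  by (simp_all add: dual_embed_def fun_scale_def fun_eq_iff)

lemma dual_embed_scale_pure_add:
  assumes "vs_scale P = fun_scale" "vs_scale Q = fun_scale"
  shows "dual_embed (fun_scale c (pure P Q f g) + t) x = fun_scale (c * f x) g + dual_embed t x"
proof
  show "dual_embed (fun_scale c (pure P Q f g) + t) x y = (fun_scale (c * f x) g + dual_embed t x) y" for y
    by (simp add: dual_embed_add dual_embed_fun_scale dual_embed_pure[OF assms])
      (simp add: fun_scale_def)
qed

lemma dual_embed_row:
  assumes "function_space P" "function_space Q" "t \<in> vs_carrier (tensor P Q)"
  shows "dual_embed t x \<in> vs_carrier Q"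
  using assms(3)
proof (induction rule: tensor_induct)
  case zero
  have "dual_embed (0 :: ('a, 'b \<Rightarrow> 'a, 'c \<Rightarrow> 'a) tensor) x = 0"
    by (simp add: dual_embed_def fun_eq_iff)
  with assms(2) show ?case by (simp only: function_space_iff FS.subspace_0)
next
  case (pure c f g t)
  have "dual_embed (fun_scale c (pure P Q f g) + t) x = fun_scale (c * f x) g + dual_embed t x"
    using assms(1,2) by (intro dual_embed_scale_pure_add) (simp_all add: function_space_def)
  with pure assms(2) show ?case
    by (simp only: function_space_iff FS.subspace_add FS.subspace_scale)
qed

text \<open>Write \<open>t\<close> as a sum of elementary tensors of \<open>f\<close> and
  \<open>g\<close>. Interpolation expresses every \<open>f\<close> through its values at the nodes
  in \<open>S\<close>; collecting terms, the second factor that accompanies \<open>F x\<close> is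
  the row \<open>dual_embed t x\<close>. Thus \<open>t\<close> is determined by its rows.\<close>

lemma tensor_expansion:
  assumes P: "function_space P" and Q: "function_space Q" and t: "t \<in> vs_carrier (tensor P Q)"
  obtains S F where "finite S" "F ` S \<subseteq> vs_carrier P"
    "\<And>B. bilinear_on P Q base_field B \<Longrightarrow> t B = (\<Sum>x\<in>S. B (F x) (dual_embed t x))"
proof -
  have sc: "vs_scale P = fun_scale" using P by (simp add: function_space_def)
  define rep where "rep A S F \<longleftrightarrow> finite S \<and> F ` S \<subseteq> vs_carrier P \<and>
    (\<forall>f\<in>A. \<forall>z. f z = (\<Sum>x\<in>S. f x * F x z))" for A S and F :: "'b \<Rightarrow> 'b \<Rightarrow> 'a"
  define expands where "expands t S F \<longleftrightarrow>
    (\<forall>B. bilinear_on P Q base_field B \<longrightarrow> t B = (\<Sum>x\<in>S. B (F x) (dual_embed t x)))"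
    for t S and F :: "'b \<Rightarrow> 'b \<Rightarrow> 'a"
  \<comment> \<open>One choice of nodes must serve all first factors at once. The induction
    therefore only collects these factors in \<open>A\<close> and proves the expansion for every
    \<open>S\<close> and \<open>F\<close> that reproduce \<open>A\<close>; the nodes are chosen
    afterwards.\<close>
  have "\<exists>A. finite A \<and> A \<subseteq> vs_carrier P \<and> (\<forall>S F. rep A S F \<longrightarrow> expands t S F)"
    using t
  proof (induction rule: tensor_induct)
    case zero
    have z: "dual_embed (0 :: ('a, 'b \<Rightarrow> 'a, 'c \<Rightarrow> 'a) tensor) = (\<lambda>x. 0)"
      by (simp add: dual_embed_def fun_eq_iff)
    have "B f 0 = 0" if "bilinear_on P Q base_field B" "f \<in> vs_carrier P" for B f
      using that Q by (intro linear_functional_zero[of Q]) (auto simp: bilinear_on_def function_space_def)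
    then have "(\<Sum>x\<in>S. B (F x) 0) = 0"
      if "rep {} S F" "bilinear_on P Q base_field B" for S F B
      using that unfolding rep_def by (intro sum.neutral ballI) blast
    then show ?case
      unfolding expands_def z by (intro exI[of _ "{}"]) simp
  next
    case (pure c f g t)
    then obtain A where A: "finite A" "A \<subseteq> vs_carrier P"
      and IH: "\<And>S F. rep A S F \<Longrightarrow> expands t S F" by blast
    have "(fun_scale c (pure P Q f g) + t) B =
        (\<Sum>x\<in>S. B (F x) (dual_embed (fun_scale c (pure P Q f g) + t) x))"
      if rep: "rep (insert f A) S F" and B: "bilinear_on P Q base_field B" for S F B
    proof -
      from rep have S: "finite S" and F: "\<And>x. x \<in> S \<Longrightarrow> F x \<in> vs_carrier P"
        and fz: "\<And>z. f z = (\<Sum>x\<in>S. f x * F x z)" and rep': "rep A S F" unfolding rep_def by blast+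
      have f: "f = (\<Sum>x\<in>S. vs_scale P (f x) (F x))"
        unfolding sc
      proof
        fix z
        have "(\<Sum>x\<in>S. fun_scale (f x) (F x)) z = (\<Sum>x\<in>S. f x * F x z)"
          using S by (induction S rule: finite_induct) (auto simp: fun_scale_def)
        with fz[of z] show "f z = (\<Sum>x\<in>S. fun_scale (f x) (F x)) z" by (rule trans[OF _ sym])
      qed
      have lin: "linear_on P base_field (\<lambda>f. B f g)" using B pure(2) by (simp add: bilinear_on_def)
      have "B f g = B (\<Sum>x\<in>S. vs_scale P (f x) (F x)) g"
        by (rule arg_cong[OF f, of "\<lambda>h. B h g"])
      also have "\<dots> = (\<Sum>x\<in>S. f x * B (F x) g)"
        using P F by (intro linear_functional_sum[OF _ lin]) (auto simp: function_space_def)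
      finally have Bf: "B f g = (\<Sum>x\<in>S. f x * B (F x) g)" .
      have row: "dual_embed (fun_scale c (pure P Q f g) + t) x =
          fun_scale (c * f x) g + dual_embed t x" for x
        using P Q by (intro dual_embed_scale_pure_add) (simp_all add: function_space_def)
      have "B (F x) (fun_scale (c * f x) g + dual_embed t x) =
          c * (f x * B (F x) g) + B (F x) (dual_embed t x)" if "x \<in> S" for x
      proof -
        have lin: "linear_on Q base_field (B (F x))" using B F that by (simp add: bilinear_on_def)
        have "fun_scale (c * f x) g \<in> vs_carrier Q"
          using Q pure(2) by (simp add: function_space_iff FS.subspace_scale)
        from linear_on_add[OF lin this dual_embed_row[OF P Q pure(3)]]
          linear_on_scale[OF lin pure(2), of "c * f x"] Q
        show ?thesis by (simp add: function_space_def base_field_def mult.assoc)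
      qed
      moreover have "(fun_scale c (pure P Q f g) + t) B = c * B f g + t B"
        using B by (simp add: fun_scale_def pure_def)
      ultimately show ?thesis
        using IH[OF rep', unfolded expands_def, rule_format, OF B]
        by (simp add: row sum.distrib Bf sum_distrib_left)
    qed
    with A pure(1) show ?case
      unfolding expands_def by (intro exI[of _ "insert f A"]) blast
  qed
  then obtain A where A: "finite A" "A \<subseteq> vs_carrier P"
    and expand: "\<And>S F. rep A S F \<Longrightarrow> expands t S F" by blast
  from finite_interpolation[OF A(1)] obtain S F where S: "finite S" "\<forall>x\<in>S. F x \<in> FS.span A"
    "\<forall>f\<in>FS.span A. \<forall>z. f z = (\<Sum>x\<in>S. f x * F x z)" by (elim exE conjE) (rule that)
  moreover have "FS.span A \<subseteq> vs_carrier P"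
    using A(2) P by (intro FS.span_minimal) (auto simp: function_space_iff)
  ultimately have "F ` S \<subseteq> vs_carrier P" by blast
  moreover from this S have "rep A S F" unfolding rep_def by (blast intro: FS.span_base)
  ultimately show thesis
    using expand[of S F] S(1) unfolding expands_def by (intro that[of S F]) simp_all
qed

text \<open>The default value 0 of \<open>pure\<close> passes to spans. This disposes of the
  non-bilinear arguments when tensors are compared as functions.\<close>

lemma tensor_eval_not_bilinear:
  assumes "t \<in> vs_carrier (tensor V W)" "\<not> bilinear_on V W base_field B"
  shows "t B = 0"
  using assms(1)
  by (induction rule: tensor_induct) (use assms(2) in \<open>auto simp: pure_def fun_scale_def\<close>)

text \<open>All rows of the difference vanish, so its expansion along rows is zero at every bilinear
  form.\<close>

lemma dual_embed_inject:
  assumes "function_space P" "function_space Q"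
    and "s \<in> vs_carrier (tensor P Q)" "t \<in> vs_carrier (tensor P Q)" "dual_embed s = dual_embed t"
  shows "s = t"
proof -
  let ?d = "s - t"
  have "?d \<in> vs_carrier (tensor P Q)"
    using assms(3,4) by (simp add: tensor_def FS.span_diff)
  from assms(1,2) this obtain S F where "finite S" and F: "F ` S \<subseteq> vs_carrier P"
    and exp: "\<And>B. bilinear_on P Q base_field B \<Longrightarrow> ?d B = (\<Sum>x\<in>S. B (F x) (dual_embed ?d x))"
    by (rule tensor_expansion) (rule that)
  have "dual_embed ?d = (\<lambda>x y. dual_embed s x y - dual_embed t x y)"
    by (simp add: dual_embed_def)
  then have z: "dual_embed ?d x = 0" for x using assms(5) by (simp add: fun_eq_iff)
  have "?d B = 0" for B
  proof (cases "bilinear_on P Q base_field B")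
    case True
    have "B f 0 = 0" if "f \<in> vs_carrier P" for f
      using that True assms(2)
      by (intro linear_functional_zero[of Q]) (auto simp: bilinear_on_def function_space_def)
    then have "(\<Sum>x\<in>S. B (F x) (dual_embed ?d x)) = 0"
      unfolding z using F by (intro sum.neutral ballI) blast
    with exp[OF True] show ?thesis by (rule trans)
  next
    case False
    then show ?thesis using assms(3,4) by (simp add: tensor_eval_not_bilinear)
  qed
  then show ?thesis by (simp add: fun_eq_iff)
qed

text \<open>Each row lies in the inner tensor product, so injectivity applies first to the rows and
  then to the outer tensors. Identities between triple tensors become identities between trilinear
  forms.\<close>

lemma dual_embed_inject3:
  assumes "function_space P" "function_space Q" "function_space R"
    and "s \<in> vs_carrier (tensor P (tensor Q R))" "t \<in> vs_carrier (tensor P (tensor Q R))"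
    and "\<And>x y z. dual_embed (dual_embed s x) y z = dual_embed (dual_embed t x) y z"
  shows "s = t"
proof (rule dual_embed_inject[OF assms(1) function_space_tensor assms(4,5)])
  show "dual_embed s = dual_embed t"
  proof
    fix x
    show "dual_embed s x = dual_embed t x"
      using dual_embed_row[OF assms(1) function_space_tensor] assms
      by (intro dual_embed_inject[OF assms(2,3)]) (auto simp: fun_eq_iff)
  qed
qed

lemma dual_embed_tensor_map:
  assumes "vs_scale P = fun_scale" "vs_scale Q = fun_scale"
  shows "dual_embed (tensor_map P Q f g t) x y = t (\<lambda>v w. f v x * g w y)"
  by (simp add: dual_embed_def tensor_map_def bilinear_on_eval_mult[OF assms])

text \<open>Interpolating the columns at the nodes in \<open>S\<close> gives the preimage: the sum
  of the tensors of \<open>F x\<close> with the row \<open>b x\<close>. Only the rows at nodes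
  occur, and each \<open>F x\<close> lies in the span of \<open>A\<close>, hence in
  \<open>P\<close>.\<close>

lemma dual_embed_finite_rank:
  assumes P: "function_space P" and Q: "function_space Q"
    and rows: "\<And>x. b x \<in> vs_carrier Q"
    and cols: "\<And>y. (\<lambda>x. b x y) \<in> FS.span A" "finite A" "A \<subseteq> vs_carrier P"
  shows "\<exists>t\<in>vs_carrier (tensor P Q). dual_embed t = b"
proof -
  from finite_interpolation[OF cols(2)] obtain S F where S: "finite S" and F: "\<forall>x\<in>S. F x \<in> FS.span A"
    and rep: "\<forall>f\<in>FS.span A. \<forall>z. f z = (\<Sum>x\<in>S. f x * F x z)" by (elim exE conjE) (rule that)
  have "FS.span A \<subseteq> vs_carrier P"
    using cols(3) P by (intro FS.span_minimal) (auto simp: function_space_iff)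
  with F have F: "F x \<in> vs_carrier P" if "x \<in> S" for x using that by blast
  let ?t = "\<Sum>x\<in>S. pure P Q (F x) (b x)"
  have "?t \<in> vs_carrier (tensor P Q)"
    using function_space_tensor[of P Q]
    by (intro FS.subspace_sum pure_in_tensor F rows) (auto simp: function_space_iff)
  moreover have "dual_embed ?t z y = b z y" for z y
  proof -
    have "dual_embed ?t z y = (\<Sum>x\<in>S. dual_embed (pure P Q (F x) (b x)) z y)"
      using S by (induction S rule: finite_induct) (auto simp: dual_embed_def)
    also have "\<dots> = (\<Sum>x\<in>S. b x y * F x z)"
      using P Q by (simp add: dual_embed_pure function_space_def mult.commute)
    also have "\<dots> = b z y" using rep[rule_format, OF cols(1)[of y], of z] by (rule sym)
    finally show ?thesis .
  qed
  ultimately show ?thesis by (intro bexI[of _ ?t]) (auto simp: fun_eq_iff)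
qed

lemma dual_comap_eqI:
  assumes "function_space P" "function_space Q"
    and "t \<in> vs_carrier (tensor P Q)" "\<And>x y. dual_embed t x y = \<xi> (r x y)"
  shows "dual_comap P Q r \<xi> = t"
  unfolding dual_comap_def
  using assms dual_embed_inject[OF assms(1,2)] by (intro the_equality) (auto simp: fun_eq_iff)

lemma linear_on_pullback:
  assumes "vs_scale P = fun_scale" "vs_scale P' = fun_scale"
    and "\<And>f. f \<in> vs_carrier P \<Longrightarrow> f \<circ> h \<in> vs_carrier P'"
  shows "linear_on P P' (pullback h)"
  using assms by (auto simp: linear_on_def fun_scale_def fun_eq_iff)

text \<open>
  The comultiplication (\<open>P = Q = G\<^sup>\<circ>\<close>, \<open>r = \<mu>\<close>) and the coaction (\<open>P = M\<^sup>\<circ>\<close>, \<open>Q = G\<^sup>\<circ>\<close>, \<open>r = \<rho>\<close>)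
  are treated together. The assumption makes the description in \<open>dual_comap\<close> satisfiable.
\<close>

locale dual_comap_pair =
  fixes P :: "('k::field, 'x \<Rightarrow> 'k) vs" and Q :: "('k, 'y \<Rightarrow> 'k) vs" and r :: "'x \<Rightarrow> 'y \<Rightarrow> 'x"
  assumes P: "function_space P" and Q: "function_space Q"
    and ex_dual_comap:
      "\<xi> \<in> vs_carrier P \<Longrightarrow> \<exists>t\<in>vs_carrier (tensor P Q). dual_embed t = (\<lambda>x y. \<xi> (r x y))"
begin

lemma dual_comap:
  assumes "\<xi> \<in> vs_carrier P"
  shows dual_comap_in: "dual_comap P Q r \<xi> \<in> vs_carrier (tensor P Q)"
    and dual_embed_dual_comap: "dual_embed (dual_comap P Q r \<xi>) x y = \<xi> (r x y)"
proof -
  from ex_dual_comap[OF assms] obtain t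
    where t: "t \<in> vs_carrier (tensor P Q)" "dual_embed t = (\<lambda>x y. \<xi> (r x y))" by blast
  then have "dual_comap P Q r \<xi> = t" by (intro dual_comap_eqI[OF P Q]) auto
  with t show "dual_comap P Q r \<xi> \<in> vs_carrier (tensor P Q)"
    "dual_embed (dual_comap P Q r \<xi>) x y = \<xi> (r x y)" by simp_all
qed

lemma linear_on_dual_comap: "linear_on P (tensor P Q) (dual_comap P Q r)"
  unfolding linear_on_def
proof (intro conjI allI ballI funcsetI)
  show "dual_comap P Q r \<xi> \<in> vs_carrier (tensor P Q)" if "\<xi> \<in> vs_carrier P" for \<xi>
    using dual_comap_in[OF that] .
  show "dual_comap P Q r (\<xi> + \<eta>) = dual_comap P Q r \<xi> + dual_comap P Q r \<eta>"
    if "\<xi> \<in> vs_carrier P" "\<eta> \<in> vs_carrier P" for \<xi> \<eta>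
    using dual_comap_in[OF that(1)] dual_comap_in[OF that(2)] that is_vs_tensor[of P Q]
    by (intro dual_comap_eqI[OF P Q]) (auto simp: is_vs_add dual_embed_add dual_embed_dual_comap)
  show "dual_comap P Q r (vs_scale P c \<xi>) = vs_scale (tensor P Q) c (dual_comap P Q r \<xi>)"
    if "\<xi> \<in> vs_carrier P" for c \<xi>
    using dual_comap_in[OF that] that is_vs_scale[OF is_vs_tensor[of P Q]] P
      function_space_tensor[of P Q]
    by (intro dual_comap_eqI[OF P Q])
      (auto simp: function_space_def dual_embed_fun_scale dual_embed_dual_comap, simp add: fun_scale_def)
qed

text \<open>Both sides represent the form \<open>\<xi> (r (k x) (h y))\<close>. The instances with
  \<open>h\<close> equal to \<beta> or \<alpha> give the compatibility of comultiplication and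
  coaction with the structure maps; the instance with \<open>h\<close> the identity and
  \<open>k\<close> equal to \<sigma> gives the morphism property.\<close>

lemma dual_comap_pullback:
  assumes P': "function_space P'" and Q': "function_space Q'"
    and k: "\<And>f. f \<in> vs_carrier P \<Longrightarrow> f \<circ> k \<in> vs_carrier P'"
    and h: "\<And>f. f \<in> vs_carrier Q \<Longrightarrow> f \<circ> h \<in> vs_carrier Q'"
    and kr: "\<And>x y. k (r' x y) = r (k x) (h y)"
    and \<xi>: "\<xi> \<in> vs_carrier P"
  shows "dual_comap P' Q' r' (\<xi> \<circ> k) =
    tensor_map P' Q' (pullback k) (pullback h) (dual_comap P Q r \<xi>)"
proof (rule dual_comap_eqI[OF P' Q'])
  show "tensor_map P' Q' (pullback k) (pullback h) (dual_comap P Q r \<xi>) \<in> vs_carrier (tensor P' Q')"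
    using P Q P' Q' k h dual_comap_in[OF \<xi>]
    by (intro tensor_map_in_tensor linear_on_pullback) (auto simp: function_space_def)
  show "dual_embed (tensor_map P' Q' (pullback k) (pullback h) (dual_comap P Q r \<xi>)) x y =
      (\<xi> \<circ> k) (r' x y)" for x y
    using P' Q' dual_embed_dual_comap[OF \<xi>, of "k x" "h y"]
    by (subst dual_embed_tensor_map) (simp_all add: function_space_def dual_embed_def kr)
qed

text \<open>As trilinear forms the two sides are \<open>\<xi> (r (r x y) (\<beta> z))\<close> and
  \<open>\<xi> (r (\<kappa> x) (\<mu> y z))\<close>, which \<open>assoc\<close> identifies.\<close>

lemma dual_comap_assoc:
  assumes \<Delta>: "dual_comap_pair Q Q \<mu>"
    and \<kappa>: "\<And>f. f \<in> vs_carrier P \<Longrightarrow> f \<circ> \<kappa> \<in> vs_carrier P"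
    and \<beta>: "\<And>f. f \<in> vs_carrier Q \<Longrightarrow> f \<circ> \<beta> \<in> vs_carrier Q"
    and assoc: "\<And>m g h. r (r m g) (\<beta> h) = r (\<kappa> m) (\<mu> g h)"
    and \<xi>: "\<xi> \<in> vs_carrier P"
  shows "tensor_assoc P Q Q (tensor_map (tensor P Q) Q (dual_comap P Q r) (pullback \<beta>) (dual_comap P Q r \<xi>)) =
    tensor_map P (tensor Q Q) (pullback \<kappa>) (dual_comap Q Q \<mu>) (dual_comap P Q r \<xi>)"
proof (rule dual_embed_inject3[OF P Q Q])
  interpret \<Delta>: dual_comap_pair Q Q \<mu> by (rule \<Delta>)
  let ?t = "dual_comap P Q r \<xi>"
  let ?l = "tensor_map (tensor P Q) Q (dual_comap P Q r) (pullback \<beta>) ?t"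
  let ?r = "tensor_map P (tensor Q Q) (pullback \<kappa>) (dual_comap Q Q \<mu>) ?t"
  note t = dual_comap_in[OF \<xi>]
  have vs: "is_vs P" "is_vs Q" "vs_scale P = fun_scale" "vs_scale Q = fun_scale"
    and scT: "vs_scale (tensor P Q) = fun_scale" "vs_scale (tensor Q Q) = fun_scale"
    using P Q function_space_tensor[of P Q] function_space_tensor[of Q Q]
    by (simp_all add: function_space_def)
  have lin\<beta>: "linear_on Q Q (pullback \<beta>)" by (rule linear_on_pullback[OF vs(4,4) \<beta>])
  have lin\<kappa>: "linear_on P P (pullback \<kappa>)" by (rule linear_on_pullback[OF vs(3,3) \<kappa>])
  have l: "?l \<in> vs_carrier (tensor (tensor P Q) Q)"
    by (rule tensor_map_in_tensor[OF linear_on_dual_comap lin\<beta> t])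
  then show "tensor_assoc P Q Q ?l \<in> vs_carrier (tensor P (tensor Q Q))"
    by (intro tensor_assoc_in_tensor vs)
  show "?r \<in> vs_carrier (tensor P (tensor Q Q))"
    by (rule tensor_map_in_tensor[OF lin\<kappa> \<Delta>.linear_on_dual_comap t])
  fix x y z
  have "dual_embed (dual_embed ?r x) y z = ?t (\<lambda>v w. (v \<circ> \<kappa>) x * dual_comap Q Q \<mu> w (\<lambda>f g. f y * g z))"
    by (simp add: dual_embed_tensor_map[OF vs(3) scT(2)] dual_embed_def[of "dual_embed ?r x"])
  also have "\<dots> = ?t (\<lambda>v w. v (\<kappa> x) * w (\<mu> y z))"
  \<comment> \<open>The inner \<open>dual_comap\<close> is known only for \<open>w\<close> in the
    carrier of \<open>Q\<close>, so the forms are compared on carriers.\<close>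
  proof (rule tensor_eval_cong[OF t])
    show "bilinear_on P Q base_field (\<lambda>v w. (v \<circ> \<kappa>) x * dual_comap Q Q \<mu> w (\<lambda>f g. f y * g z))"
      using bilinear_on_comp[OF bilinear_on_eval_mult[OF vs(3) scT(2)] lin\<kappa> \<Delta>.linear_on_dual_comap] .
    show "bilinear_on P Q base_field (\<lambda>v w. v (\<kappa> x) * w (\<mu> y z))"
      by (rule bilinear_on_eval_mult[OF vs(3,4)])
    show "(v \<circ> \<kappa>) x * dual_comap Q Q \<mu> w (\<lambda>f g. f y * g z) = v (\<kappa> x) * w (\<mu> y z)"
      if "w \<in> vs_carrier Q" for v w
      using \<Delta>.dual_embed_dual_comap[OF that, of y z] by (simp add: dual_embed_def)
  qed
  also have "\<dots> = \<xi> (r (\<kappa> x) (\<mu> y z))"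
    using dual_embed_dual_comap[OF \<xi>] by (simp add: dual_embed_def)
  finally have R: "dual_embed (dual_embed ?r x) y z = \<xi> (r (\<kappa> x) (\<mu> y z))" .
  have b: "bilinear_on P (tensor Q Q) base_field (\<lambda>f s. f x * s (\<lambda>f g. f y * g z))"
    by (rule bilinear_on_eval_mult[OF vs(3) scT(2)])
  have pure_eval: "pure Q Q v w (\<lambda>f g. f y * g z) = v y * w z" for v w
    using dual_embed_pure[OF vs(4,4), of v w] by (simp add: dual_embed_def fun_eq_iff)
  have lin: "linear_on (tensor P Q) base_field (\<lambda>s. s B)" for B by (rule linear_on_eval[OF scT(1)])
  \<comment> \<open>Reassociation leaves the constant factor inside the argument of
    \<open>s\<close>. It can be pulled out because \<open>s\<close> is a tensor; an arbitrary
    function of forms would not permit this.\<close>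
  have eval3: "s (\<lambda>u v. u x * (v y * c)) = dual_embed s x y * c" if "s \<in> vs_carrier (tensor P Q)" for s c
    using that
  proof (induction rule: tensor_induct)
    case zero
    show ?case by (simp add: dual_embed_def)
  next
    case (pure d f g s)
    have "bilinear_on P Q base_field (\<lambda>u v. u x * (v y * c))"
      using vs by (simp add: bilinear_on_def linear_on_def base_field_def fun_scale_def algebra_simps)
    moreover have "dual_embed (fun_scale d (pure P Q f g) + s) x y =
        d * (f x * g y) + dual_embed s x y"
      by (simp add: dual_embed_add dual_embed_fun_scale dual_embed_pure[OF vs(3,4)])
    ultimately show ?case
      using pure(4) by (simp only:) (simp add: fun_scale_def pure_def algebra_simps)
  qed
  have b2: "bilinear_on (tensor P Q) Q base_field (\<lambda>s w. dual_embed s x y * w z)"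
    using bilinear_on_comp[OF bilinear_on_mult lin linear_on_eval[OF vs(4)]]
    by (simp add: dual_embed_def)
  \<comment> \<open>Bilinearity is a condition on carriers, where this form agrees with the one in
    \<open>b2\<close>.\<close>
  have b3: "bilinear_on (tensor P Q) Q base_field (\<lambda>s w. s (\<lambda>u v. u x * (v y * w z)))"
    using b2 by (simp add: bilinear_on_def linear_on_def base_field_def eval3 is_vs_add[OF is_vs_tensor]
        is_vs_scale[OF is_vs_tensor])
  have "dual_embed (dual_embed (tensor_assoc P Q Q ?l) x) y z = ?l (\<lambda>s w. s (\<lambda>u v. u x * (v y * w z)))"
    using b by (simp add: dual_embed_def tensor_assoc_def pure_eval)
  also have "\<dots> = ?l (\<lambda>s w. dual_embed s x y * w z)"
    by (rule tensor_eval_cong[OF l b3 b2]) (simp add: eval3)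
  also have "\<dots> = ?t (\<lambda>v w. dual_embed (dual_comap P Q r v) x y * w (\<beta> z))"
    using b2 by (simp add: tensor_map_def)
  also have "\<dots> = ?t (\<lambda>v w. v (r x y) * w (\<beta> z))"
  proof (rule tensor_eval_cong[OF t])
    show "bilinear_on P Q base_field (\<lambda>v w. dual_embed (dual_comap P Q r v) x y * w (\<beta> z))"
      using bilinear_on_comp[OF b2 linear_on_dual_comap lin\<beta>] by simp
    show "bilinear_on P Q base_field (\<lambda>v w. v (r x y) * w (\<beta> z))"
      by (rule bilinear_on_eval_mult[OF vs(3,4)])
  qed (simp add: dual_embed_dual_comap)
  also have "\<dots> = \<xi> (r (r x y) (\<beta> z))"
    using dual_embed_dual_comap[OF \<xi>] by (simp add: dual_embed_def)
  finally show "dual_embed (dual_embed (tensor_assoc P Q Q ?l) x) y z = dual_embed (dual_embed ?r x) y z"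
    using R by (simp add: assoc)
qed

end


section \<open>Sweedler duals\<close>

lemma vector_space_mult: "vector_space ((*) :: 'k::field \<Rightarrow> 'k \<Rightarrow> 'k)"
  by unfold_locales (auto simp: algebra_simps)

lemma zero_on_mod_mult_iff:
  assumes "Vector_Spaces.linear sM (*) f"
  shows "(\<forall>x\<in>mod_mult sM \<rho> J. f x = 0) \<longleftrightarrow> (\<forall>m. \<forall>j\<in>J. f (\<rho> m j) = 0)"
proof -
  interpret f: Vector_Spaces.linear sM "(*)" f by (rule assms)
  show ?thesis
  proof
    show "\<forall>m. \<forall>j\<in>J. f (\<rho> m j) = 0" if "\<forall>x\<in>mod_mult sM \<rho> J. f x = 0"
      using that by (auto simp: mod_mult_def intro!: f.vs1.span_base)
    show "\<forall>x\<in>mod_mult sM \<rho> J. f x = 0" if "\<forall>m. \<forall>j\<in>J. f (\<rho> m j) = 0"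
      unfolding mod_mult_def by (intro ballI, erule f.eq_0_on_span[rotated]) (use that in auto)
  qed
qed

lemma sweedler_mod_iff:
  "f \<in> vs_carrier (sweedler_mod sG \<mu> \<alpha> \<beta> sM \<rho>) \<longleftrightarrow> Vector_Spaces.linear sM (*) f \<and>
    (\<exists>J. bihom_ideal sG \<mu> \<alpha> \<beta> J \<and> finite_codim sG J \<and> (\<forall>m. \<forall>j\<in>J. f (\<rho> m j) = 0))"
  by (auto simp: sweedler_mod_def zero_on_mod_mult_iff)

lemma sweedler_alg_iff:
  "f \<in> vs_carrier (sweedler_alg sG \<mu> \<alpha> \<beta>) \<longleftrightarrow> Vector_Spaces.linear sG (*) f \<and>
    (\<exists>J. bihom_ideal sG \<mu> \<alpha> \<beta> J \<and> finite_codim sG J \<and> (\<forall>j\<in>J. f j = 0))"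
  by (auto simp: sweedler_alg_def)

text \<open>
  The family \<open>a\<close> is the action \<open>\<rho>\<close> for \<open>M\<^sup>\<circ>\<close>; for \<open>G\<^sup>\<circ>\<close> it is the identity.
\<close>

lemma function_space_annihilators:
  fixes sM :: "'k::field \<Rightarrow> 'm::ab_group_add \<Rightarrow> 'm" and sG :: "'k \<Rightarrow> 'g::ab_group_add \<Rightarrow> 'g"
  assumes "vector_space sG" "vector_space sM" "vs_scale P = fun_scale"
    and iff: "\<And>f. f \<in> vs_carrier P \<longleftrightarrow> Vector_Spaces.linear sM (*) f \<and>
      (\<exists>J. bihom_ideal sG \<mu> \<alpha> \<beta> J \<and> finite_codim sG J \<and> (\<forall>i. \<forall>j\<in>J. f (a i j) = 0))"
  shows "function_space P"
proof -
  interpret G: vector_space sG by (rule assms(1))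
  have zero: "0 \<in> vs_carrier P"
    using assms(2) G.bihom_ideal_UNIV G.finite_codim_UNIV
    by (auto simp: iff Vector_Spaces.linear_iff vector_space_mult)
  \<comment> \<open>The summands may come with different ideals; the sum vanishes for the
    intersection, which again has finite codimension.\<close>
  have add: "f + g \<in> vs_carrier P" if f: "f \<in> vs_carrier P" and g: "g \<in> vs_carrier P" for f g
  proof -
    from f obtain J where J: "bihom_ideal sG \<mu> \<alpha> \<beta> J" "finite_codim sG J" "\<forall>i. \<forall>j\<in>J. f (a i j) = 0"
      by (auto simp: iff)
    from g obtain K where K: "bihom_ideal sG \<mu> \<alpha> \<beta> K" "finite_codim sG K" "\<forall>i. \<forall>j\<in>K. g (a i j) = 0"
      by (auto simp: iff)
    have "Vector_Spaces.linear sM (*) (f + g)"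
      using f g by (simp add: iff Vector_Spaces.linear_iff algebra_simps)
    moreover have "finite_codim sG (J \<inter> K)"
      using J K by (intro G.finite_codim_Int) (auto simp: bihom_ideal_def)
    ultimately show ?thesis
      using G.bihom_ideal_Int[OF J(1) K(1)] J(3) K(3) unfolding iff
      by (intro conjI exI[of _ "J \<inter> K"]) auto
  qed
  have scale: "fun_scale c f \<in> vs_carrier P" if f: "f \<in> vs_carrier P" for c f
  proof -
    have "Vector_Spaces.linear sM (*) (fun_scale c f)"
      using f by (simp add: iff Vector_Spaces.linear_iff fun_scale_def algebra_simps)
    with f show ?thesis unfolding iff by (auto simp: fun_scale_def)
  qed
  show ?thesis
    using assms(3) zero add scale by (auto simp: function_space_iff FS.subspace_def)
qed

text \<open>The twist \<open>h\<close> covers \<kappa> with \<alpha>, \<tau> with \<beta>, and a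
  module morphism with the identity. The ideal that belongs to \<open>f\<close> also works for the
  pullback, because \<open>h\<close> maps it into itself.\<close>

lemma sweedler_mod_pullback:
  assumes "Vector_Spaces.linear sM sN \<sigma>"
    and "\<And>m g. \<sigma> (\<rho> m g) = \<rho>' (\<sigma> m) (h g)"
    and "\<And>J. bihom_ideal sG \<mu> \<alpha> \<beta> J \<Longrightarrow> h ` J \<subseteq> J"
    and "f \<in> vs_carrier (sweedler_mod sG \<mu> \<alpha> \<beta> sN \<rho>')"
  shows "f \<circ> \<sigma> \<in> vs_carrier (sweedler_mod sG \<mu> \<alpha> \<beta> sM \<rho>)"
proof -
  from assms(4) obtain J where J: "bihom_ideal sG \<mu> \<alpha> \<beta> J" "finite_codim sG J"
    "\<forall>m. \<forall>j\<in>J. f (\<rho>' m j) = 0" and f: "Vector_Spaces.linear sN (*) f" by (auto simp: sweedler_mod_iff)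
  have "\<forall>m. \<forall>j\<in>J. (f \<circ> \<sigma>) (\<rho> m j) = 0" using J(3) assms(3)[OF J(1)] by (auto simp: assms(2))
  with J(1,2) Vector_Spaces.linear_compose[OF assms(1) f] show ?thesis unfolding sweedler_mod_iff by blast
qed

lemma sweedler_alg_pullback:
  assumes "Vector_Spaces.linear sG sG h" "\<And>J. bihom_ideal sG \<mu> \<alpha> \<beta> J \<Longrightarrow> h ` J \<subseteq> J"
    and "f \<in> vs_carrier (sweedler_alg sG \<mu> \<alpha> \<beta>)"
  shows "f \<circ> h \<in> vs_carrier (sweedler_alg sG \<mu> \<alpha> \<beta>)"
proof -
  from assms(3) obtain J where J: "bihom_ideal sG \<mu> \<alpha> \<beta> J" "finite_codim sG J"
    "\<forall>j\<in>J. f j = 0" and f: "Vector_Spaces.linear sG (*) f" by (auto simp: sweedler_alg_iff)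
  have "\<forall>j\<in>J. (f \<circ> h) j = 0" using J(3) assms(2)[OF J(1)] by auto
  with J(1,2) Vector_Spaces.linear_compose[OF assms(1) f] show ?thesis unfolding sweedler_alg_iff by blast
qed

text \<open>The finite set \<open>B\<close> of representatives modulo \<open>J\<close> yields
  finitely many columns that span all of them. The hypothesis \<open>cols\<close> stays open because
  its reasons differ: for \<mu> it holds since \<open>J\<close> is two-sided, for \<rho> since
  \<beta> is surjective.\<close>

lemma ex_dual_comap_of_ideal:
  fixes sM :: "'k::field \<Rightarrow> 'm::ab_group_add \<Rightarrow> 'm" and sG :: "'k \<Rightarrow> 'g::ab_group_add \<Rightarrow> 'g"
  assumes P: "function_space P" and Q: "function_space (sweedler_alg sG \<mu> \<alpha> \<beta>)"
    and lin: "\<And>m. Vector_Spaces.linear sG sM (r m)" and \<xi>: "Vector_Spaces.linear sM (*) \<xi>"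
    and J: "bihom_ideal sG \<mu> \<alpha> \<beta> J" "finite_codim sG J" "\<And>m j. j \<in> J \<Longrightarrow> \<xi> (r m j) = 0"
    and cols: "\<And>g. (\<lambda>m. \<xi> (r m g)) \<in> vs_carrier P"
  shows "\<exists>t\<in>vs_carrier (tensor P (sweedler_alg sG \<mu> \<alpha> \<beta>)). dual_embed t = (\<lambda>x y. \<xi> (r x y))"
proof -
  have lin\<xi>: "Vector_Spaces.linear sG (*) (\<lambda>g. \<xi> (r m g))" for m
    using Vector_Spaces.linear_compose[OF lin \<xi>] by (simp add: o_def)
  then interpret G: vector_space sG by (simp add: Vector_Spaces.linear_iff)
  from J(2) obtain B where B: "finite B" "\<And>x. \<exists>b\<in>G.span B. x - b \<in> J"
    by (auto simp: finite_codim_def)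
  let ?col = "\<lambda>g m. \<xi> (r m g)"
  have add: "?col (x + y) = ?col x + ?col y" and scale: "?col (sG c x) = fun_scale c (?col x)" for c x y
    using lin\<xi> by (auto simp: Vector_Spaces.linear_iff fun_scale_def fun_eq_iff)
  have span: "?col b \<in> FS.span (?col ` B)" if "b \<in> G.span B" for b
    using that
  proof (induction rule: G.span_induct_alt)
    case base
    have "?col (sG 0 0) = 0" unfolding scale by (simp add: fun_scale_def fun_eq_iff)
    then have "?col 0 = 0" by simp
    then show ?case by (simp add: FS.span_zero)
  next
    case (step c x y)
    then show ?case unfolding add scale by (intro FS.span_add FS.span_scale) (auto intro: FS.span_base)
  qed
  show ?thesis
  proof (rule dual_embed_finite_rank[OF P Q, where A = "?col ` B"])
    show "(\<lambda>g. \<xi> (r m g)) \<in> vs_carrier (sweedler_alg sG \<mu> \<alpha> \<beta>)" for m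
      using lin\<xi> J by (auto simp: sweedler_alg_iff)
    show "?col g \<in> FS.span (?col ` B)" for g
    proof -
      from B(2) obtain b where b: "b \<in> G.span B" "g - b \<in> J" by blast
      \<comment> \<open>Congruent elements modulo \<open>J\<close> have the same column.\<close>
      have "?col (g - b) = 0" using J(3)[OF b(2)] by (simp add: fun_eq_iff)
      with add[of b "g - b"] have "?col g = ?col b" by simp
      with span[OF b(1)] show ?thesis by simp
    qed
  qed (use B(1) cols in auto)
qed

section \<open>The coalgebra structure on \<open>G\<^sup>\<circ>\<close>\<close>

context bihom_algebra
begin

abbreviation "dualG \<equiv> sweedler_alg scale \<mu> \<alpha> \<beta>"

lemma function_space_sweedler_alg: "function_space dualG"
  by (rule function_space_annihilators[OF vector_space_axioms vector_space_axioms, where a = "\<lambda>_::unit. \<lambda>x. x"])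
    (simp_all add: sweedler_alg_iff, simp add: sweedler_alg_def)

lemma pullback_\<alpha>: "f \<in> vs_carrier dualG \<Longrightarrow> f \<circ> \<alpha> \<in> vs_carrier dualG"
  by (rule sweedler_alg_pullback[OF \<alpha>_linear]) (simp_all add: bihom_ideal_def)

lemma pullback_\<beta>: "f \<in> vs_carrier dualG \<Longrightarrow> f \<circ> \<beta> \<in> vs_carrier dualG"
  by (rule sweedler_alg_pullback[OF \<beta>_linear]) (simp_all add: bihom_ideal_def)

sublocale \<Delta>: dual_comap_pair dualG dualG \<mu>
proof
  show "function_space dualG" by (rule function_space_sweedler_alg)
  fix \<xi> assume "\<xi> \<in> vs_carrier dualG"
  then obtain J where \<xi>: "Vector_Spaces.linear scale (*) \<xi>"
    and J: "bihom_ideal scale \<mu> \<alpha> \<beta> J" "finite_codim scale J" "\<forall>j\<in>J. \<xi> j = 0"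
    by (auto simp: sweedler_alg_iff)
  \<comment> \<open>The first equation makes the rows vanish on \<open>J\<close>, the second one the
    columns.\<close>
  have van: "\<xi> (\<mu> g j) = 0" "\<xi> (\<mu> j g) = 0" if "j \<in> J" for g j
    using J(1,3) that by (auto simp: bihom_ideal_def)
  show "\<exists>t\<in>vs_carrier (tensor dualG dualG). dual_embed t = (\<lambda>x y. \<xi> (\<mu> x y))"
  proof (rule ex_dual_comap_of_ideal[OF function_space_sweedler_alg function_space_sweedler_alg
        mult_linear_right \<xi> J(1,2) van(1)])
    show "(\<lambda>m. \<xi> (\<mu> m g)) \<in> vs_carrier dualG" for g
      using Vector_Spaces.linear_compose[OF mult_linear_left \<xi>, of g] J(1,2) van(2)
      by (auto simp: sweedler_alg_iff o_def)
  qed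
qed

text \<open>\<open>G\<close> acts on itself by \<mu>, with \<alpha> in the place of \<kappa>.
  Coassociativity is then the transpose of \<open>bihom_assoc\<close>, and the other two
  compatibilities are the transposes of \<open>\<beta>_mult\<close> and
  \<open>\<alpha>_mult\<close>.\<close>

lemma bihom_coalgebra_sweedler_alg:
  "bihom_coalgebra dualG (sweedler_comult scale \<mu> \<alpha> \<beta>) (pullback \<beta>) (pullback \<alpha>)"
proof
  have sc: "vs_scale dualG = fun_scale" by (simp add: sweedler_alg_def)
  show "is_vs dualG" using function_space_sweedler_alg by (simp add: function_space_def)
  show "linear_on dualG (tensor dualG dualG) (sweedler_comult scale \<mu> \<alpha> \<beta>)"
    by (rule \<Delta>.linear_on_dual_comap)
  show "linear_on dualG dualG (pullback \<beta>)" "linear_on dualG dualG (pullback \<alpha>)"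
    by (intro linear_on_pullback sc pullback_\<beta> pullback_\<alpha>; assumption)+
  fix x assume x: "x \<in> vs_carrier dualG"
  show "pullback \<beta> (pullback \<alpha> x) = pullback \<alpha> (pullback \<beta> x)"
    using \<alpha>_\<beta>_commute by (simp add: comp_assoc)
  show "tensor_map dualG (tensor dualG dualG) (pullback \<alpha>) (sweedler_comult scale \<mu> \<alpha> \<beta>)
      (sweedler_comult scale \<mu> \<alpha> \<beta> x) =
    tensor_assoc dualG dualG dualG (tensor_map (tensor dualG dualG) dualG
      (sweedler_comult scale \<mu> \<alpha> \<beta>) (pullback \<beta>) (sweedler_comult scale \<mu> \<alpha> \<beta> x))"
    by (rule \<Delta>.dual_comap_assoc[symmetric, OF \<Delta>.dual_comap_pair_axioms pullback_\<alpha> pullback_\<beta> _ x])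
      (simp_all add: bihom_assoc)
  show "sweedler_comult scale \<mu> \<alpha> \<beta> (pullback \<beta> x) =
      tensor_map dualG dualG (pullback \<beta>) (pullback \<beta>) (sweedler_comult scale \<mu> \<alpha> \<beta> x)"
    by (rule \<Delta>.dual_comap_pullback[OF \<Delta>.P \<Delta>.Q pullback_\<beta> pullback_\<beta> \<beta>_mult x])
  show "sweedler_comult scale \<mu> \<alpha> \<beta> (pullback \<alpha> x) =
      tensor_map dualG dualG (pullback \<alpha>) (pullback \<alpha>) (sweedler_comult scale \<mu> \<alpha> \<beta> x)"
    by (rule \<Delta>.dual_comap_pullback[OF \<Delta>.P \<Delta>.Q pullback_\<alpha> pullback_\<alpha> \<alpha>_mult x])
qed

end

section \<open>The comodule structure on \<open>M\<^sup>\<circ>\<close>\<close>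

context bihom_module
begin

abbreviation "dualM \<equiv> sweedler_mod scaleG \<mu> \<alpha> \<beta> scaleM \<rho>"

lemma function_space_sweedler_mod: "function_space dualM"
  by (rule function_space_annihilators[OF vector_space_axioms M.vector_space_axioms, where a = \<rho>])
    (simp_all add: sweedler_mod_iff, simp add: sweedler_mod_def)

lemma pullback_\<kappa>: "f \<in> vs_carrier dualM \<Longrightarrow> f \<circ> \<kappa> \<in> vs_carrier dualM"
  by (rule sweedler_mod_pullback[OF \<kappa>_linear, where h = \<alpha> and \<rho>' = \<rho>]) (simp_all add: bihom_ideal_def \<kappa>_act \<tau>_act)

lemma pullback_\<tau>: "f \<in> vs_carrier dualM \<Longrightarrow> f \<circ> \<tau> \<in> vs_carrier dualM"
  by (rule sweedler_mod_pullback[OF \<tau>_linear, where h = \<beta> and \<rho>' = \<rho>]) (simp_all add: bihom_ideal_def \<kappa>_act \<tau>_act)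

lemma dual_comap_pair_sweedler_mod:
  assumes "surj \<beta>"
  shows "dual_comap_pair dualM dualG \<rho>"
proof
  show "function_space dualM" "function_space dualG"
    by (rule function_space_sweedler_mod function_space_sweedler_alg)+
  fix \<xi> assume "\<xi> \<in> vs_carrier dualM"
  then obtain J where \<xi>: "Vector_Spaces.linear scaleM (*) \<xi>"
    and J: "bihom_ideal scaleG \<mu> \<alpha> \<beta> J" "finite_codim scaleG J" "\<And>m j. j \<in> J \<Longrightarrow> \<xi> (\<rho> m j) = 0"
    by (auto simp: sweedler_mod_iff)
  show "\<exists>t\<in>vs_carrier (tensor dualM dualG). dual_embed t = (\<lambda>x y. \<xi> (\<rho> x y))"
  proof (rule ex_dual_comap_of_ideal[OF function_space_sweedler_mod function_space_sweedler_alg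
        act_linear_right \<xi> J])
    show "(\<lambda>m. \<xi> (\<rho> m g)) \<in> vs_carrier dualM" for g
    proof -
      \<comment> \<open>Writing \<open>g\<close> as \<open>\<beta> h\<close> lets
        \<open>act_assoc\<close> move \<open>g\<close> next to \<open>j\<close>, where the ideal
        absorbs it; the column at \<open>g\<close> is thus annihilated with the same
        \<open>J\<close> as \<xi>.\<close>
      from assms obtain h where g: "g = \<beta> h" by (meson surjD)
      have "\<xi> (\<rho> (\<rho> m j) g) = 0" if "j \<in> J" for m j
        using J(1,3) that by (auto simp: g act_assoc bihom_ideal_def)
      with Vector_Spaces.linear_compose[OF act_linear_left \<xi>, of g] J(1,2) show ?thesis
        by (auto simp: sweedler_mod_iff o_def)
    qed
  qed
qed

text \<open>The coaction axioms are the transposes of \<open>act_assoc\<close>,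
  \<open>\<tau>_act\<close> and \<open>\<kappa>_act\<close>.\<close>

lemma bihom_comodule_sweedler_mod:
  assumes "surj \<beta>"
  shows "bihom_comodule dualG (sweedler_comult scaleG \<mu> \<alpha> \<beta>) (pullback \<beta>) (pullback \<alpha>)
    dualM (sweedler_coact scaleG \<mu> \<alpha> \<beta> scaleM \<rho>) (pullback \<tau>) (pullback \<kappa>)"
proof (intro bihom_comodule.intro bihom_coalgebra_sweedler_alg, unfold_locales)
  interpret \<gamma>: dual_comap_pair dualM dualG \<rho> by (rule dual_comap_pair_sweedler_mod[OF assms])
  have sc: "vs_scale dualM = fun_scale" by (simp add: sweedler_mod_def)
  show "is_vs dualM" using function_space_sweedler_mod by (simp add: function_space_def)
  show "linear_on dualM (tensor dualM dualG) (sweedler_coact scaleG \<mu> \<alpha> \<beta> scaleM \<rho>)"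
    by (rule \<gamma>.linear_on_dual_comap)
  show "linear_on dualM dualM (pullback \<tau>)" "linear_on dualM dualM (pullback \<kappa>)"
    by (intro linear_on_pullback sc pullback_\<tau> pullback_\<kappa>; assumption)+
  fix x assume x: "x \<in> vs_carrier dualM"
  show "pullback \<tau> (pullback \<kappa> x) = pullback \<kappa> (pullback \<tau> x)"
    using \<kappa>_\<tau>_commute by (simp add: comp_assoc)
  show "tensor_assoc dualM dualG dualG (tensor_map (tensor dualM dualG) dualG
      (sweedler_coact scaleG \<mu> \<alpha> \<beta> scaleM \<rho>) (pullback \<beta>) (sweedler_coact scaleG \<mu> \<alpha> \<beta> scaleM \<rho> x)) =
    tensor_map dualM (tensor dualG dualG) (pullback \<kappa>) (sweedler_comult scaleG \<mu> \<alpha> \<beta>)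
      (sweedler_coact scaleG \<mu> \<alpha> \<beta> scaleM \<rho> x)"
    by (rule \<gamma>.dual_comap_assoc[OF \<Delta>.dual_comap_pair_axioms pullback_\<kappa> pullback_\<beta> act_assoc x])
  show "tensor_map dualM dualG (pullback \<tau>) (pullback \<beta>) (sweedler_coact scaleG \<mu> \<alpha> \<beta> scaleM \<rho> x) =
      sweedler_coact scaleG \<mu> \<alpha> \<beta> scaleM \<rho> (pullback \<tau> x)"
    by (rule \<gamma>.dual_comap_pullback[symmetric, OF \<gamma>.P \<gamma>.Q pullback_\<tau> pullback_\<beta> \<tau>_act[symmetric] x])
  show "tensor_map dualM dualG (pullback \<kappa>) (pullback \<alpha>) (sweedler_coact scaleG \<mu> \<alpha> \<beta> scaleM \<rho> x) =
      sweedler_coact scaleG \<mu> \<alpha> \<beta> scaleM \<rho> (pullback \<kappa> x)"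
    by (rule \<gamma>.dual_comap_pullback[symmetric, OF \<gamma>.P \<gamma>.Q pullback_\<kappa> pullback_\<alpha> \<kappa>_act[symmetric] x])
qed

end

section \<open>The dual of a module morphism\<close>

theorem theorem5:
  fixes sG :: "'k::field_char_0 \<Rightarrow> 'g::ab_group_add \<Rightarrow> 'g"
    and \<mu> :: "'g \<Rightarrow> 'g \<Rightarrow> 'g" and \<alpha> \<beta> :: "'g \<Rightarrow> 'g"
    and sM :: "'k \<Rightarrow> 'm::ab_group_add \<Rightarrow> 'm"
    and \<rho> :: "'m \<Rightarrow> 'g \<Rightarrow> 'm" and \<kappa> \<tau> :: "'m \<Rightarrow> 'm"
    and sN :: "'k \<Rightarrow> 'n::ab_group_add \<Rightarrow> 'n"
    and \<rho>' :: "'n \<Rightarrow> 'g \<Rightarrow> 'n" and \<kappa>' \<tau>' :: "'n \<Rightarrow> 'n"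
    and \<sigma> :: "'m \<Rightarrow> 'n"
  assumes "bihom_algebra sG \<mu> \<alpha> \<beta>"
    and "surj \<beta>"
    and "bihom_module sG \<mu> \<alpha> \<beta> sM \<rho> \<kappa> \<tau>"
    and "bihom_module sG \<mu> \<alpha> \<beta> sN \<rho>' \<kappa>' \<tau>'"
    and "bihom_module_morphism sG \<mu> \<alpha> \<beta> sM \<rho> \<kappa> \<tau> sN \<rho>' \<kappa>' \<tau>' \<sigma>"
  shows "bihom_comodule_morphism
    (sweedler_alg sG \<mu> \<alpha> \<beta>) (sweedler_comult sG \<mu> \<alpha> \<beta>) (pullback \<beta>) (pullback \<alpha>)
    (sweedler_mod sG \<mu> \<alpha> \<beta> sN \<rho>') (sweedler_coact sG \<mu> \<alpha> \<beta> sN \<rho>') (pullback \<tau>') (pullback \<kappa>')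
    (sweedler_mod sG \<mu> \<alpha> \<beta> sM \<rho>) (sweedler_coact sG \<mu> \<alpha> \<beta> sM \<rho>) (pullback \<tau>) (pullback \<kappa>)
    (pullback \<sigma>)"
proof -
  interpret \<sigma>: bihom_module_morphism sG \<mu> \<alpha> \<beta> sM \<rho> \<kappa> \<tau> sN \<rho>' \<kappa>' \<tau>' \<sigma> by fact
  interpret \<gamma>': dual_comap_pair \<sigma>.N.dualM \<sigma>.M.dualG \<rho>'
    by (rule \<sigma>.N.dual_comap_pair_sweedler_mod) fact
  \<comment> \<open>Well-definedness: \<sigma> carries the action of \<open>J\<close> on
    \<open>M\<close> to its action on \<open>N\<close>, so an ideal for \<open>f\<close> is one for
    the pullback.\<close>
  have pullback_\<sigma>: "f \<circ> \<sigma> \<in> vs_carrier \<sigma>.M.dualM" if "f \<in> vs_carrier \<sigma>.N.dualM" for f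
    using sweedler_mod_pullback[OF \<sigma>.\<sigma>_linear, of \<rho> \<rho>' "\<lambda>g. g"] that
    by (simp add: \<sigma>.\<sigma>_act)
  show ?thesis
  proof (intro bihom_comodule_morphism.intro \<sigma>.M.bihom_comodule_sweedler_mod
      \<sigma>.N.bihom_comodule_sweedler_mod assms(2), unfold_locales)
    show "linear_on \<sigma>.N.dualM \<sigma>.M.dualM (pullback \<sigma>)"
      by (intro linear_on_pullback pullback_\<sigma>) (simp_all add: sweedler_mod_def)
    fix x assume x: "x \<in> vs_carrier \<sigma>.N.dualM"
    show "sweedler_coact sG \<mu> \<alpha> \<beta> sM \<rho> (pullback \<sigma> x) =
        tensor_map \<sigma>.M.dualM \<sigma>.M.dualG (pullback \<sigma>) (\<lambda>c. c) (sweedler_coact sG \<mu> \<alpha> \<beta> sN \<rho>' x)"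
      \<comment> \<open>The tensor for \<open>x\<close> over \<open>N\<close> is mapped to one that
        represents the form of the pullback over \<open>M\<close>; uniqueness identifies it with the
        coaction there.\<close>
      using \<gamma>'.dual_comap_pullback[OF \<sigma>.M.function_space_sweedler_mod \<gamma>'.Q pullback_\<sigma>,
          where h = "\<lambda>g. g" and r' = \<rho>] x
      by (simp add: \<sigma>.\<sigma>_act o_def)
    show "pullback \<tau> (pullback \<sigma> x) = pullback \<sigma> (pullback \<tau>' x)"
      using \<sigma>.\<sigma>_\<tau> by (simp add: comp_assoc)
    show "pullback \<kappa> (pullback \<sigma> x) = pullback \<sigma> (pullback \<kappa>' x)"
      using \<sigma>.\<sigma>_\<kappa> by (simp add: comp_assoc)
  qed
qed

end
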